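(* Suppose $A$ has full column rank, so that $r+q=n$ in the generalized singular value decomposition (GSVD) of $\{A,L\}$, and let $\sigma_i=1$ for $1\le i\le r$. Let $\theta_1^{(k)}>\theta_2^{(k)}>\dots>\theta_k^{(k)}>0$ be the singular values of $B_k$, and let $\xi_1\ge\xi_2\ge\dots\ge\xi_n$ be the generalized eigenvalues of $A^TAz=\xi Gz$, i.e. $\xi_i=1$ for $1\le i\le r$ and $\xi_i=\gamma_i^2/(\gamma_i^2+\alpha)$ for $r+1\le i\le r+q=n$. Then the $k$-th regularized solution $x_k$ obtained by the pGKB based subspace projection regularization algorithm can be written as $$x_k=\sum_{i=1}^{n} f_i^{(k)}\,\frac{u_{A,i}^Tb}{\sigma_i}\,z_i,$$ with filter factors $$f_i^{(k)}=1-\prod_{j=1}^{k}\frac{(\theta_j^{(k)})^2-\xi_i}{(\theta_j^{(k)})^2},\qquad i=1,\dots,n.$$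
   Context: Setting. $A\in\mathbb{R}^{m\times n}$, $b\in\mathbb{R}^m$, $M\in\mathbb{R}^{n\times n}$ is symmetric positive semidefinite, written $M=L^TL$ with $L\in\mathbb{R}^{p\times n}$, $p\le n$, $\mathrm{rank}(L)=p$. It is assumed that $\mathcal{N}(A)\cap\mathcal{N}(L)=\{\mathbf 0\}$. Let $\alpha>0$ and $G=A^TA+\alpha M$, which is symmetric positive definite; $\langle x,x'\rangle_G=x^TGx'$ and $\|x\|_G=(x^TGx)^{1/2}$. GSVD of $\{A,L\}$: $A=U_AD_AZ^{-1}$, $L=U_LD_LZ^{-1}$ with $U_A\in\mathbb{R}^{m\times m}$, $U_L\in\mathbb{R}^{p\times p}$ orthogonal, $Z\in\mathbb{R}^{n\times n}$ invertible, and block diagonal (possibly with empty blocks) $D_A=\mathrm{diag}(I_A,\Sigma_A,O_A)\in\mathbb{R}^{m\times n}$ with row block sizes $r,\,q,\,m-r-q$, and $D_L=\mathrm{diag}(O_L,\Sigma_L,I_L)\in\mathbb{R}^{p\times n}$ with row block sizes $p+r-n,\,q,\,n-r-q$; the column block sizes of both are $r,\,q,\,n-r-q$. Here $I_A,I_L$ are identity matrices, $O_A,O_L$ are zero matrices, $\Sigma_A=\mathrm{diag}(\sigma_{r+1},\dots,\sigma_{r+q})$, $\Sigma_L=\mathrm{diag}(\rho_{r+1},\dots,\rho_{r+q})$, $1>\sigma_{r+1}\ge\dots\ge\sigma_{r+q}>0$, $0<\rho_{r+1}\le\dots\le\rho_{r+q}<1$, $\sigma_i^2+\rho_i^2=1$,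 and $\gamma_i=\sigma_i/\rho_i$. The columns of $U_A$ and $Z$ are denoted $u_{A,1},\dots,u_{A,m}$ and $z_1,\dots,z_n$. Preconditioned Golub-Kahan bidiagonalization (pGKB). With $w_0=\mathbf 0$, the process is $\beta_1u_1=b$, $\alpha_1w_1=G^{-1}A^Tu_1$, and for $i\ge1$: $\beta_{i+1}u_{i+1}=Aw_i-\alpha_iu_i$, $\alpha_{i+1}w_{i+1}=G^{-1}A^Tu_{i+1}-\beta_{i+1}w_i$, where the scalars $\alpha_i,\beta_i\ge0$ are the norms making $\|u_i\|_2=\|w_i\|_G=1$ (so $\beta_1=\|b\|_2$, $\beta_{i+1}=\|Aw_i-\alpha_iu_i\|_2$, $\alpha_{i+1}=\|G^{-1}A^Tu_{i+1}-\beta_{i+1}w_i\|_G$). (The scalars $\alpha_i$ are distinct from the parameter $\alpha$.) It is assumed that the process does not terminate within $k$ steps, i.e. $\alpha_i,\beta_i\ne0$ for $1\le i\le k$. Put $W_k=(w_1,\dots,w_k)\in\mathbb{R}^{n\times k}$ and let $B_k\in\mathbb{R}^{(k+1)\times k}$ be the lower bidiagonal matrix with diagonal entries $(B_k)_{i,i}=\alpha_i$ and subdiagonal entries $(B_k)_{i+1,i}=\beta_{i+1}$, $1\le i\le k$, all other entries zero. pGKB based subspace projection regularization: the $k$-th solution is $x_k=W_ky_k$ where $y_k$ is the unique minimizer of $\|B_ky-\beta_1e_1\|_2$ over $y\in\mathbb{R}^k$, with $e_1$ the first column of the identity matrix of order $k+1$; equivalently $x_k$ is the unique minimizer of $\|Ax-b\|_2$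 over $x\in\mathrm{span}\{W_k\}$. *)

theory Defs
  imports
    Complex_Main
    "Jordan_Normal_Form.DL_Rank"
    "Jordan_Normal_Form.Gauss_Jordan_Elimination"
    "Jordan_Normal_Form.Matrix_Kernel"
begin

text \<open>All indices are 0-based, as usual for \<^typ>\<open>'a mat\<close>: the entry, column, scalar or vector
  with index \<open>i\<close> below is the one with index \<open>i + 1\<close> in the usual 1-based notation.\<close>

definition norm_vec2 :: "real vec \<Rightarrow> real" where
  "norm_vec2 v = sqrt (v \<bullet> v)"

definition norm_vecG :: "real mat \<Rightarrow> real vec \<Rightarrow> real" where
  "norm_vecG G v = sqrt (v \<bullet> (G *\<^sub>v v))"

text \<open>The library predicate \<^const>\<open>orthogonal_mat\<close> does not require the columns to have norm 1.\<close>

definition orthonormal_mat :: "nat \<Rightarrow> real mat \<Rightarrow> bool" where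
  "orthonormal_mat n U \<longleftrightarrow> U \<in> carrier_mat n n \<and> transpose_mat U * U = 1\<^sub>m n"

text \<open>Meaningful for invertible square matrices only.\<close>

definition mat_inv :: "real mat \<Rightarrow> real mat" where
  "mat_inv X = the (mat_inverse X)"


subsection \<open>Singular values, generalized eigenvalues, GSVD\<close>

definition is_singular_values :: "real mat \<Rightarrow> (nat \<Rightarrow> real) \<Rightarrow> bool" where
  "is_singular_values B \<theta> \<longleftrightarrow>
     (\<forall>i < min (dim_row B) (dim_col B). \<theta> i \<ge> 0) \<and>
     (\<forall>i j. i \<le> j \<longrightarrow> j < min (dim_row B) (dim_col B) \<longrightarrow> \<theta> j \<le> \<theta> i) \<and>
     (\<exists>U V. orthonormal_mat (dim_row B) U \<and> orthonormal_mat (dim_col B) V \<and>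
        B = U * mat (dim_row B) (dim_col B) (\<lambda>(i, j). if i = j then \<theta> i else 0)
              * transpose_mat V)"

text \<open>The numbers \<open>\<xi> 0 \<ge> \<dots> \<ge> \<xi> (n - 1)\<close> are the generalized eigenvalues of the problem
  \<open>K z = \<xi> G z\<close>, repeated according to multiplicity: the columns of \<open>X\<close> are a basis of generalized
  eigenvectors. Such a basis exists whenever \<open>K\<close> is symmetric and \<open>G\<close> is symmetric positive
  definite.\<close>

definition is_generalized_eigenvalues ::
    "nat \<Rightarrow> real mat \<Rightarrow> real mat \<Rightarrow> (nat \<Rightarrow> real) \<Rightarrow> bool" where
  "is_generalized_eigenvalues n K G \<xi> \<longleftrightarrow>
     (\<forall>i j. i \<le> j \<longrightarrow> j < n \<longrightarrow> \<xi> j \<le> \<xi> i) \<and>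
     (\<exists>X \<in> carrier_mat n n. invertible_mat X \<and>
        (\<forall>i < n. K *\<^sub>v col X i = \<xi> i \<cdot>\<^sub>v (G *\<^sub>v col X i)))"

text \<open>Generalized singular value decomposition of the pair \<open>{A, L}\<close>. The middle blocks are
  \<open>diag (\<sigma> r, \<dots>, \<sigma> (r + q - 1))\<close> and \<open>diag (\<rho> r, \<dots>, \<rho> (r + q - 1))\<close>. The values of \<open>\<sigma>\<close> and
  \<open>\<rho>\<close> at other indices are unconstrained. Any of the blocks may be empty.\<close>

definition is_gsvd ::
    "real mat \<Rightarrow> real mat \<Rightarrow> nat \<Rightarrow> nat \<Rightarrow> nat \<Rightarrow> nat \<Rightarrow> nat \<Rightarrow>
     real mat \<Rightarrow> real mat \<Rightarrow> real mat \<Rightarrow> (nat \<Rightarrow> real) \<Rightarrow> (nat \<Rightarrow> real) \<Rightarrow> bool" where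
  "is_gsvd A L m n p r q U\<^sub>A U\<^sub>L Z \<sigma> \<rho> \<longleftrightarrow>
     r + q \<le> m \<and> r + q \<le> n \<and> n \<le> p + r \<and>
     orthonormal_mat m U\<^sub>A \<and> orthonormal_mat p U\<^sub>L \<and>
     Z \<in> carrier_mat n n \<and> invertible_mat Z \<and>
     A = U\<^sub>A * diag_block_mat
               [1\<^sub>m r, mat_diag q (\<lambda>i. \<sigma> (r + i)), 0\<^sub>m (m - r - q) (n - r - q)]
            * mat_inv Z \<and>
     L = U\<^sub>L * diag_block_mat
               [0\<^sub>m (p + r - n) r, mat_diag q (\<lambda>i. \<rho> (r + i)), 1\<^sub>m (n - r - q)]
            * mat_inv Z \<and>
     (\<forall>i \<in> {r..<r + q}. 0 < \<sigma> i \<and> \<sigma> i < 1 \<and> 0 < \<rho> i \<and> \<rho> i < 1 \<and>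
        (\<sigma> i)\<^sup>2 + (\<rho> i)\<^sup>2 = 1) \<and>
     (\<forall>i j. r \<le> i \<longrightarrow> i \<le> j \<longrightarrow> j < r + q \<longrightarrow> \<sigma> j \<le> \<sigma> i \<and> \<rho> i \<le> \<rho> j)"


subsection \<open>Preconditioned Golub-Kahan bidiagonalization\<close>

text \<open>\<open>pgkb A G b i\<close> is the quadruple \<open>(\<beta>, u, \<alpha>, w)\<close> of 1-based index \<open>i + 1\<close>. If a norm vanishes,
  the process has terminated and the values from there on are junk (by \<open>1 / 0 = 0\<close>).\<close>

fun pgkb :: "real mat \<Rightarrow> real mat \<Rightarrow> real vec \<Rightarrow> nat \<Rightarrow>
    real \<times> real vec \<times> real \<times> real vec" where
  "pgkb A G b 0 =
     (let \<beta> = norm_vec2 b;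
          u = (1 / \<beta>) \<cdot>\<^sub>v b;
          s = mat_inv G *\<^sub>v (transpose_mat A *\<^sub>v u);
          \<alpha> = norm_vecG G s;
          w = (1 / \<alpha>) \<cdot>\<^sub>v s
      in (\<beta>, u, \<alpha>, w))"
| "pgkb A G b (Suc i) =
     (case pgkb A G b i of (_, u, \<alpha>, w) \<Rightarrow>
       let t = A *\<^sub>v w - \<alpha> \<cdot>\<^sub>v u;
           \<beta>' = norm_vec2 t;
           u' = (1 / \<beta>') \<cdot>\<^sub>v t;
           s = mat_inv G *\<^sub>v (transpose_mat A *\<^sub>v u') - \<beta>' \<cdot>\<^sub>v w;
           \<alpha>' = norm_vecG G s;
           w' = (1 / \<alpha>') \<cdot>\<^sub>v s
       in (\<beta>', u', \<alpha>', w'))"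

definition pgkb_beta :: "real mat \<Rightarrow> real mat \<Rightarrow> real vec \<Rightarrow> nat \<Rightarrow> real" where
  "pgkb_beta A G b i = (case pgkb A G b i of (\<beta>, u, \<alpha>, w) \<Rightarrow> \<beta>)"

definition pgkb_alpha :: "real mat \<Rightarrow> real mat \<Rightarrow> real vec \<Rightarrow> nat \<Rightarrow> real" where
  "pgkb_alpha A G b i = (case pgkb A G b i of (\<beta>, u, \<alpha>, w) \<Rightarrow> \<alpha>)"

definition pgkb_w :: "real mat \<Rightarrow> real mat \<Rightarrow> real vec \<Rightarrow> nat \<Rightarrow> real vec" where
  "pgkb_w A G b i = (case pgkb A G b i of (\<beta>, u, \<alpha>, w) \<Rightarrow> w)"

definition pgkb_W :: "real mat \<Rightarrow> real mat \<Rightarrow> real vec \<Rightarrow> nat \<Rightarrow> real mat" where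
  "pgkb_W A G b k = mat_of_cols (dim_col A) (map (pgkb_w A G b) [0..<k])"

definition pgkb_B :: "real mat \<Rightarrow> real mat \<Rightarrow> real vec \<Rightarrow> nat \<Rightarrow> real mat" where
  "pgkb_B A G b k = mat (k + 1) k (\<lambda>(i, j).
     if i = j then pgkb_alpha A G b j
     else if i = j + 1 then pgkb_beta A G b (j + 1)
     else 0)"

definition pgkb_y :: "real mat \<Rightarrow> real mat \<Rightarrow> real vec \<Rightarrow> nat \<Rightarrow> real vec" where
  "pgkb_y A G b k = (THE y. is_arg_min
     (\<lambda>y. norm_vec2 (pgkb_B A G b k *\<^sub>v y - pgkb_beta A G b 0 \<cdot>\<^sub>v unit_vec (k + 1) 0))
     (\<lambda>y. y \<in> carrier_vec k) y)"

definition pgkb_solution :: "real mat \<Rightarrow> real mat \<Rightarrow> real vec \<Rightarrow> nat \<Rightarrow> real vec" where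
  "pgkb_solution A G b k = pgkb_W A G b k *\<^sub>v pgkb_y A G b k"

end

theory Submission
  imports Defs
begin

text \<open>Write \<open>K = G\<^sup>-\<^sup>1 A\<^sup>T A\<close> and \<open>g = G\<^sup>-\<^sup>1 A\<^sup>T b\<close>, so that the least squares problem for \<open>A\<close> and \<open>b\<close>
  has the normal equations \<open>K x = g\<close>. In the basis of the columns of \<open>Z\<close> the operator \<open>K\<close> is the
  diagonal matrix of the \<open>\<xi>\<^sub>i\<close>, and the solution of \<open>K x = g\<close> has the coordinates
  \<open>c\<^sub>i = (u\<^sub>i\<^sup>T b) / \<sigma>\<^sub>i\<close> (\<open>gsvd_normal_operator\<close>).

  The proof rests on the Richardson iteration \<open>x \<leftarrow> x + (g - K x) / t\<^sub>j\<close> started at \<open>0\<close>. One step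
  multiplies the \<open>i\<close>-th coordinate of the error by \<open>1 - \<xi>\<^sub>i / t\<^sub>j\<close>. Hence \<open>k\<close> steps with
  \<open>t\<^sub>j = \<theta>\<^sub>j\<^sup>2\<close> produce the vector with coordinates \<open>f\<^sub>i c\<^sub>i\<close>, which is the right-hand side of the
  claim (\<open>richardson_diagonalized\<close>). It remains to see that the projected solution
  \<open>x\<^sub>k = W\<^sub>k y\<^sub>k\<close> is this iterate.

  Put \<open>T = B\<^sub>k\<^sup>T B\<^sub>k\<close>. Then \<open>y\<^sub>k\<close> solves \<open>T y = \<beta>\<^sub>1 \<alpha>\<^sub>1 e\<^sub>1\<close> by the normal equations of the projected
  problem, and \<open>g = \<beta>\<^sub>1 \<alpha>\<^sub>1 w\<^sub>1 = W\<^sub>k (\<beta>\<^sub>1 \<alpha>\<^sub>1 e\<^sub>1)\<close>. Two observations connect the small system with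
  the large one.

  \<^item> The eigenvalues of \<open>T\<close> are the \<open>\<theta>\<^sub>j\<^sup>2\<close>, so in each eigendirection one of the \<open>k\<close> error factors
    vanishes: the \<open>k\<close>-th iterate for \<open>T\<close> is exactly \<open>y\<^sub>k\<close> (\<open>richardson_exact\<close>).

  \<^item> The recurrences of the process give \<open>K W\<^sub>k v = W\<^sub>k T v\<close> for every \<open>v\<close> whose last entry is \<open>0\<close>. As
    \<open>T\<close> is tridiagonal and the right-hand side is a multiple of \<open>e\<^sub>1\<close>, the \<open>j\<close>-th iterate for \<open>T\<close> is
    supported on its first \<open>j\<close> entries. So \<open>W\<^sub>k\<close> maps the iterates for \<open>T\<close> to those for \<open>K\<close>, up to and
    including the \<open>k\<close>-th one (\<open>pgkb_W_richardson\<close>).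

  The \<open>\<theta>\<^sub>j\<close> are positive and distinct because \<open>B\<^sub>k\<close> is injective and an eigenvector of the tridiagonal
  matrix \<open>T\<close>, whose off-diagonal entries do not vanish, is determined by its first entry. The
  \<open>\<xi>\<^sub>i\<close> have the stated values because the eigenvalues in a diagonalization are determined up to
  their order (\<open>diagonalization_unique\<close>).\<close>

section \<open>Least squares and the normal equations\<close>

lemma scalar_prod_self_eq_0_iff:
  fixes v :: "real vec"
  assumes "v \<in> carrier_vec n"
  shows "v \<bullet> v = 0 \<longleftrightarrow> v = 0\<^sub>v n"
proof -
  have "v \<bullet> v = (\<Sum>i<n. (v $ i)\<^sup>2)"
    using assms by (simp add: scalar_prod_def power2_eq_square atLeast0LessThan)
  also have "\<dots> = 0 \<longleftrightarrow> (\<forall>i<n. v $ i = 0)"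
    by (subst sum_nonneg_eq_0_iff) auto
  finally show ?thesis using assms by (auto intro!: eq_vecI)
qed

lemma scalar_prod_self_nonneg: "(v :: real vec) \<bullet> v \<ge> 0"
  by (auto simp: scalar_prod_def intro!: sum_nonneg)

lemma mult_mat_vec_entry_sum:
  fixes M :: "real mat"
  assumes "M \<in> carrier_mat l k" "v \<in> carrier_vec k" "i < l"
  shows "(M *\<^sub>v v) $ i = (\<Sum>j<k. M $$ (i, j) * v $ j)"
  using assms by (auto simp: scalar_prod_def atLeast0LessThan intro!: sum.cong)

lemma transpose_mult_self_kernel:
  fixes B :: "real mat"
  assumes B: "B \<in> carrier_mat l k" and v: "v \<in> carrier_vec k"
    and 0: "transpose_mat B *\<^sub>v (B *\<^sub>v v) = 0\<^sub>v k"
  shows "B *\<^sub>v v = 0\<^sub>v l"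
proof -
  have Bv: "B *\<^sub>v v \<in> carrier_vec l" using B v by auto
  have "(B *\<^sub>v v) \<bullet> (B *\<^sub>v v) = (transpose_mat B *\<^sub>v (B *\<^sub>v v)) \<bullet> v"
    using transpose_vec_mult_scalar[OF B v Bv] by simp
  then show ?thesis using 0 v scalar_prod_self_eq_0_iff[OF Bv] by simp
qed

text \<open>By the normal equations the residual of \<open>y\<close> is orthogonal to the range of \<open>B\<close>, so the squared
  residual of \<open>z\<close> exceeds that of \<open>y\<close> by \<open>\<parallel>B (z - y)\<parallel>\<^sup>2\<close>, which is positive unless \<open>z = y\<close>.\<close>

lemma least_squares_minimizer:
  fixes B :: "real mat"
  assumes B: "B \<in> carrier_mat l k" and c: "c \<in> carrier_vec l" and y: "y \<in> carrier_vec k"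
    and normal: "transpose_mat B *\<^sub>v (B *\<^sub>v y) = transpose_mat B *\<^sub>v c"
    and inj: "\<And>v. v \<in> carrier_vec k \<Longrightarrow> B *\<^sub>v v = 0\<^sub>v l \<Longrightarrow> v = 0\<^sub>v k"
  shows "(THE y. is_arg_min (\<lambda>y. norm_vec2 (B *\<^sub>v y - c)) (\<lambda>y. y \<in> carrier_vec k) y) = y"
proof -
  let ?u = "B *\<^sub>v y - c"
  have u: "?u \<in> carrier_vec l" using B c y by auto
  have orth: "transpose_mat B *\<^sub>v ?u = 0\<^sub>v k"
    using B c y normal by (simp add: mult_minus_distrib_mat_vec[of _ k l])
  have pyth: "(B *\<^sub>v z - c) \<bullet> (B *\<^sub>v z - c) = ?u \<bullet> ?u + (B *\<^sub>v (z - y)) \<bullet> (B *\<^sub>v (z - y))"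
    if z: "z \<in> carrier_vec k" for z
  proof -
    let ?w = "B *\<^sub>v (z - y)"
    have w: "?w \<in> carrier_vec l" using B y z by auto
    have "?w \<bullet> ?u = (transpose_mat B *\<^sub>v ?u) \<bullet> (z - y)"
      using transpose_vec_mult_scalar[OF B _ u, of "z - y"] y z
        comm_scalar_prod[OF w u] by simp
    then have wu: "?w \<bullet> ?u = 0" "?u \<bullet> ?w = 0"
      using orth y z comm_scalar_prod[OF w u] by auto
    have "?w = B *\<^sub>v z - B *\<^sub>v y" using B y z by (simp add: mult_minus_distrib_mat_vec)
    then have "B *\<^sub>v z - c = ?u + ?w" using B y z c by (auto intro!: eq_vecI)
    then show ?thesis
      using u w wu by (simp add: add_scalar_prod_distrib[of _ l] scalar_prod_add_distrib[of _ l])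
  qed
  have strict: "norm_vec2 ?u < norm_vec2 (B *\<^sub>v z - c)" if z: "z \<in> carrier_vec k" "z \<noteq> y" for z
  proof -
    let ?w = "B *\<^sub>v (z - y)"
    have "z - y \<noteq> 0\<^sub>v k"
    proof
      assume eq: "z - y = 0\<^sub>v k"
      have "z $ i = y $ i" if "i < k" for i
        using arg_cong[OF eq, of "\<lambda>v. v $ i"] that z y by simp
      with z y show False by auto
    qed
    then have "?w \<noteq> 0\<^sub>v l" using inj[of "z - y"] y z by auto
    then have "?w \<bullet> ?w > 0"
      using scalar_prod_self_eq_0_iff[of ?w l] scalar_prod_self_nonneg[of ?w] B y z
      by (auto simp: less_le)
    then show ?thesis using pyth[OF z(1)] by (simp add: norm_vec2_def)
  qed
  show ?thesis
  proof (rule the_equality)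
    show "is_arg_min (\<lambda>y. norm_vec2 (B *\<^sub>v y - c)) (\<lambda>y. y \<in> carrier_vec k) y"
      using y strict by (auto simp: is_arg_min_def not_less intro: less_imp_le)
  next
    fix z assume "is_arg_min (\<lambda>y. norm_vec2 (B *\<^sub>v y - c)) (\<lambda>y. y \<in> carrier_vec k) z"
    then show "z = y" using y strict unfolding is_arg_min_def by blast
  qed
qed

section \<open>The Richardson iteration\<close>

primrec richardson :: "real mat \<Rightarrow> (nat \<Rightarrow> real) \<Rightarrow> real vec \<Rightarrow> nat \<Rightarrow> real vec" where
  "richardson T t v 0 = 0\<^sub>v (dim_vec v)"
| "richardson T t v (Suc j) =
     richardson T t v j + (1 / t j) \<cdot>\<^sub>v (v - T *\<^sub>v richardson T t v j)"

lemma richardson_carrier [simp]: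
  assumes "T \<in> carrier_mat n n" "v \<in> carrier_vec n"
  shows "richardson T t v j \<in> carrier_vec n"
  using assms by (induction j) auto

lemma mat_diag_mult_vec:
  assumes "x \<in> carrier_vec n"
  shows "mat_diag n d *\<^sub>v x = vec n (\<lambda>i. d i * x $ i :: real)"
proof (rule eq_vecI)
  fix i assume "i < dim_vec (vec n (\<lambda>i. d i * x $ i))"
  then have i: "i < n" by simp
  have "(mat_diag n d *\<^sub>v x) $ i = (\<Sum>j = 0..<n. (if i = j then d j * x $ j else 0))"
    using i assms by (simp add: mat_diag_def scalar_prod_def if_distrib[of "\<lambda>a. a * _"] cong: if_cong)
  then show "(mat_diag n d *\<^sub>v x) $ i = vec n (\<lambda>i. d i * x $ i) $ i" using i by simp
qed (simp add: mat_diag_def)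

lemma diagonalized_mult_vec:
  fixes T V :: "real mat"
  assumes T: "T \<in> carrier_mat n n" and V: "V \<in> carrier_mat n n"
    and diag: "T * V = V * mat_diag n d"
  shows "T *\<^sub>v (V *\<^sub>v vec n c) = V *\<^sub>v vec n (\<lambda>i. d i * c i)"
proof -
  have "T *\<^sub>v (V *\<^sub>v vec n c) = (T * V) *\<^sub>v vec n c"
    using T V by (simp add: assoc_mult_mat_vec[of _ n n _ n])
  also have "\<dots> = V *\<^sub>v (mat_diag n d *\<^sub>v vec n c)"
    unfolding diag using V by (simp add: assoc_mult_mat_vec[of _ n n _ n])
  also have "mat_diag n d *\<^sub>v vec n c = vec n (\<lambda>i. d i * c i)"
    by (subst mat_diag_mult_vec) auto
  finally show ?thesis .
qed

text \<open>The solution has the coordinates \<open>c\<close> in the eigenbasis \<open>V\<close>, and every step scales the \<open>i\<close>-th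
  coordinate of the error by the factor \<open>1 - d i / t l\<close>. Writing the right-hand side as \<open>d i * c i\<close>
  makes the formula valid even for a singular \<open>T\<close>.\<close>

lemma richardson_diagonalized:
  fixes T V :: "real mat"
  assumes T: "T \<in> carrier_mat n n" and V: "V \<in> carrier_mat n n"
    and diag: "T * V = V * mat_diag n d"
  shows "richardson T t (V *\<^sub>v vec n (\<lambda>i. d i * c i)) j =
    V *\<^sub>v vec n (\<lambda>i. (1 - (\<Prod>l<j. 1 - d i / t l)) * c i)"
proof (induction j)
  case 0
  then show ?case using V by (auto intro!: eq_vecI simp: scalar_prod_def)
next
  case (Suc j)
  let ?P = "\<lambda>i. \<Prod>l<j. 1 - d i / t l"
  let ?s = "vec n (\<lambda>i. (1 - ?P i) * c i)" and ?v = "vec n (\<lambda>i. d i * c i)"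
  have "richardson T t (V *\<^sub>v ?v) (Suc j)
      = V *\<^sub>v ?s + (1 / t j) \<cdot>\<^sub>v (V *\<^sub>v ?v - V *\<^sub>v vec n (\<lambda>i. d i * ((1 - ?P i) * c i)))"
    by (simp add: Suc diagonalized_mult_vec[OF T V diag])
  also have "\<dots> = V *\<^sub>v (?s + (1 / t j) \<cdot>\<^sub>v (?v - vec n (\<lambda>i. d i * ((1 - ?P i) * c i))))"
    using V by (simp add: mult_add_distrib_mat_vec[of _ n n] mult_minus_distrib_mat_vec[of _ n n]
        mult_mat_vec[of _ n n])
  also have "?s + (1 / t j) \<cdot>\<^sub>v (?v - vec n (\<lambda>i. d i * ((1 - ?P i) * c i)))
      = vec n (\<lambda>i. (1 - (\<Prod>l<Suc j. 1 - d i / t l)) * c i)"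
    by (rule eq_vecI) (auto simp: field_simps)
  finally show ?case .
qed

text \<open>With the reciprocals of the eigenvalues as step sizes, step \<open>i\<close> removes the \<open>i\<close>-th component of the
  error.\<close>

lemma richardson_exact:
  fixes T V :: "real mat"
  assumes T: "T \<in> carrier_mat n n" and V: "orthonormal_mat n V"
    and diag: "T * V = V * mat_diag n d" and d: "\<And>i. i < n \<Longrightarrow> d i \<noteq> 0"
    and v: "v \<in> carrier_vec n"
  shows "T *\<^sub>v richardson T d v n = v"
proof -
  have Vc: "V \<in> carrier_mat n n" and "transpose_mat V * V = 1\<^sub>m n"
    using V by (auto simp: orthonormal_mat_def)
  then have VV: "V * transpose_mat V = 1\<^sub>m n"
    using mat_mult_left_right_inverse[of "transpose_mat V" n V] by simp
  define c where "c i = (transpose_mat V *\<^sub>v v) $ i / d i" for i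
  have "vec n (\<lambda>i. d i * c i) = transpose_mat V *\<^sub>v v"
    by (rule eq_vecI) (use d Vc v in \<open>auto simp: c_def\<close>)
  then have Vx: "V *\<^sub>v vec n (\<lambda>i. d i * c i) = v"
    using assoc_mult_mat_vec[of V n n "transpose_mat V" n v] Vc VV v by simp
  have "vec n (\<lambda>i. (1 - (\<Prod>l<n. 1 - d i / d l)) * c i) = vec n c"
  proof (rule eq_vecI)
    fix i assume "i < dim_vec (vec n c)"
    then have i: "i < n" by simp
    then have "(\<Prod>l<n. 1 - d i / d l) = 0" using d[OF i] by (intro prod_zero) auto
    then show "vec n (\<lambda>i. (1 - (\<Prod>l<n. 1 - d i / d l)) * c i) $ i = vec n c $ i" using i by simp
  qed simp
  then have "richardson T d v n = V *\<^sub>v vec n c"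
    using richardson_diagonalized[OF T Vc diag, of d c n] Vx by simp
  then show ?thesis using diagonalized_mult_vec[OF T Vc diag, of c] Vx by simp
qed

section \<open>Bidiagonal matrices and their singular values\<close>

definition lower_bidiagonal :: "nat \<Rightarrow> (nat \<Rightarrow> real) \<Rightarrow> (nat \<Rightarrow> real) \<Rightarrow> real mat" where
  "lower_bidiagonal k a c =
     mat (k + 1) k (\<lambda>(i, j). if i = j then a j else if i = j + 1 then c j else 0)"

lemma lower_bidiagonal_carrier [simp]: "lower_bidiagonal k a c \<in> carrier_mat (k + 1) k"
  by (simp add: lower_bidiagonal_def)

lemma lower_bidiagonal_entry:
  assumes "i < k + 1" "j < k"
  shows "lower_bidiagonal k a c $$ (i, j) = (if i = j then a j else 0) + (if i = j + 1 then c j else 0)"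
  using assms by (simp add: lower_bidiagonal_def)

lemma lower_bidiagonal_mult_vec:
  assumes v: "v \<in> carrier_vec k" and i: "i < k + 1"
  shows "(lower_bidiagonal k a c *\<^sub>v v) $ i =
    (if i < k then a i * v $ i else 0) + (if 0 < i then c (i - 1) * v $ (i - 1) else 0)"
proof -
  have "(lower_bidiagonal k a c *\<^sub>v v) $ i = (\<Sum>j = 0..<k. lower_bidiagonal k a c $$ (i, j) * v $ j)"
    using v i carrier_matD[OF lower_bidiagonal_carrier[of k a c]]
    by (auto simp: scalar_prod_def intro!: sum.cong)
  also have "\<dots> = (\<Sum>j = 0..<k. (if i = j then a j * v $ j else 0))
      + (\<Sum>j = 0..<k. (if j = i - 1 then (if 0 < i then c j * v $ j else 0) else 0))"
    unfolding sum.distrib[symmetric]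
    by (rule sum.cong) (use i in \<open>auto simp: lower_bidiagonal_entry distrib_right\<close>)
  also have "\<dots> = (if i < k then a i * v $ i else 0) + (if 0 < i then c (i - 1) * v $ (i - 1) else 0)"
    using i by auto
  finally show ?thesis .
qed

lemma lower_bidiagonal_transpose_mult_vec:
  assumes u: "u \<in> carrier_vec (k + 1)" and j: "j < k"
  shows "(transpose_mat (lower_bidiagonal k a c) *\<^sub>v u) $ j = a j * u $ j + c j * u $ (j + 1)"
proof -
  have "(transpose_mat (lower_bidiagonal k a c) *\<^sub>v u) $ j
      = (\<Sum>i = 0..<k + 1. lower_bidiagonal k a c $$ (i, j) * u $ i)"
    using u j carrier_matD[OF lower_bidiagonal_carrier[of k a c]]
    by (auto simp: scalar_prod_def intro!: sum.cong)
  also have "\<dots> = (\<Sum>i = 0..<k + 1. (if i = j then a j * u $ i else 0))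
      + (\<Sum>i = 0..<k + 1. (if i = j + 1 then c j * u $ i else 0))"
    unfolding sum.distrib[symmetric]
    by (rule sum.cong) (use j in \<open>auto simp: lower_bidiagonal_entry distrib_right\<close>)
  also have "\<dots> = a j * u $ j + c j * u $ (j + 1)"
    using j by simp
  finally show ?thesis .
qed

lemma lower_bidiagonal_injective:
  assumes a: "\<And>i. i < k \<Longrightarrow> a i \<noteq> 0" and v: "v \<in> carrier_vec k"
    and 0: "lower_bidiagonal k a c *\<^sub>v v = 0\<^sub>v (k + 1)"
  shows "v = 0\<^sub>v k"
proof -
  have "v $ i = 0" if "i < k" for i
    using that
  proof (induction i)
    case 0
    then show ?case
      using lower_bidiagonal_mult_vec[OF v, of 0 a c] assms(3) a[of 0] by simp
  next
    case (Suc i)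
    then show ?case
      using lower_bidiagonal_mult_vec[OF v, of "Suc i" a c] assms(3) a[of "Suc i"] by simp
  qed
  then show ?thesis using v by (auto intro!: eq_vecI)
qed

text \<open>In row \<open>l\<close> of the eigenvalue equation for the tridiagonal matrix \<open>B\<^sup>T B\<close>, the entry of the
  eigenvector with index \<open>l + 1\<close> has the coefficient \<open>c l * a (l + 1) \<noteq> 0\<close>. It is therefore determined
  by the entries before it, and all entries vanish as soon as the first one does.\<close>

lemma bidiagonal_gram_eigenvector_first_entry:
  assumes a: "\<And>i. i < k \<Longrightarrow> a i \<noteq> 0" and c: "\<And>i. i + 1 < k \<Longrightarrow> c i \<noteq> 0"
    and v: "v \<in> carrier_vec k"
    and eig: "transpose_mat (lower_bidiagonal k a c) *\<^sub>v (lower_bidiagonal k a c *\<^sub>v v) = \<mu> \<cdot>\<^sub>v v"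
    and v0: "v $ 0 = 0"
  shows "v = 0\<^sub>v k"
proof -
  let ?B = "lower_bidiagonal k a c"
  have Bv: "?B *\<^sub>v v \<in> carrier_vec (k + 1)"
    using v lower_bidiagonal_carrier by (rule mult_mat_vec_carrier[rotated])
  have "v $ i = 0" if "i < k" for i
    using that
  proof (induction i rule: less_induct)
    case (less i)
    show ?case
    proof (cases i)
      case 0
      then show ?thesis using v0 by simp
    next
      case (Suc l)
      \<comment> \<open>Row \<open>l\<close> of the eigenvalue equation, in which only \<open>v $ Suc l\<close> survives.\<close>
      have vl: "v $ l = 0" using less Suc by simp
      have "(?B *\<^sub>v v) $ l = 0"
        using lower_bidiagonal_mult_vec[OF v, of l a c] less Suc by simp
      moreover have "(?B *\<^sub>v v) $ (l + 1) = a i * v $ i"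
        using lower_bidiagonal_mult_vec[OF v, of "l + 1" a c] vl less Suc by simp
      moreover have "\<mu> * v $ l = a l * (?B *\<^sub>v v) $ l + c l * (?B *\<^sub>v v) $ (l + 1)"
        using lower_bidiagonal_transpose_mult_vec[OF Bv, of l a c] arg_cong[OF eig, of "\<lambda>v. v $ l"]
          less.prems Suc v by simp
      ultimately have "c l * (a i * v $ i) = 0" using vl by simp
      then show ?thesis using a[of i] c[of l] less.prems Suc by simp
    qed
  qed
  then show ?thesis using v by (auto intro!: eq_vecI)
qed

lemma singular_values_diagonalize_gram:
  assumes B: "B \<in> carrier_mat l k" and lk: "k \<le> l" and sv: "is_singular_values B \<theta>"
  obtains V where "orthonormal_mat k V"
    and "(transpose_mat B * B) * V = V * mat_diag k (\<lambda>i. (\<theta> i)\<^sup>2)"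
proof -
  define S where "S = mat l k (\<lambda>(i, j). if i = j then \<theta> i else 0)"
  from sv B obtain U V where U: "orthonormal_mat l U" and V: "orthonormal_mat k V"
    and eq: "B = U * S * transpose_mat V"
    unfolding is_singular_values_def S_def by auto
  have [simp]: "U \<in> carrier_mat l l" "V \<in> carrier_mat k k" and UU: "transpose_mat U * U = 1\<^sub>m l"
    and VV: "transpose_mat V * V = 1\<^sub>m k"
    using U V by (auto simp: orthonormal_mat_def)
  have S [simp]: "S \<in> carrier_mat l k" by (simp add: S_def)
  have US: "U * S \<in> carrier_mat l k" by (rule mult_carrier_mat[of _ l l]) auto
  have SS: "transpose_mat S * S = mat_diag k (\<lambda>i. (\<theta> i)\<^sup>2)"
  proof (rule eq_matI)
    fix i j assume "i < dim_row (mat_diag k (\<lambda>i. (\<theta> i)\<^sup>2))" "j < dim_col (mat_diag k (\<lambda>i. (\<theta> i)\<^sup>2))"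
    then have ij: "i < k" "j < k" by (auto simp: mat_diag_def)
    then have "(transpose_mat S * S) $$ (i, j)
        = (\<Sum>h = 0..<l. (if h = i then \<theta> h else 0) * (if h = j then \<theta> h else 0))"
      by (simp add: scalar_prod_def S_def)
    also have "\<dots> = (\<Sum>h = 0..<l. (if h = i then (if i = j then \<theta> i * \<theta> i else 0) else 0))"
      by (rule sum.cong) auto
    also have "\<dots> = mat_diag k (\<lambda>i. (\<theta> i)\<^sup>2) $$ (i, j)"
      using ij lk by (simp add: mat_diag_def power2_eq_square)
    finally show "(transpose_mat S * S) $$ (i, j) = mat_diag k (\<lambda>i. (\<theta> i)\<^sup>2) $$ (i, j)" .
  qed (auto simp: mat_diag_def S_def)
  have SU: "transpose_mat S * transpose_mat U \<in> carrier_mat k l"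
    by (rule mult_carrier_mat[of _ k l]) auto
  have BV: "B * V = U * S"
    unfolding eq using US by (simp add: assoc_mult_mat[of _ l k _ k _ k] VV right_mult_one_mat[OF US])
  have BT: "transpose_mat B = V * (transpose_mat S * transpose_mat U)"
    unfolding eq using US
    by (simp add: transpose_mult[of _ l k _ k] transpose_mult[of _ l l _ k])
  have "(transpose_mat B * B) * V = transpose_mat B * (U * S)"
    using B by (simp add: assoc_mult_mat[of _ k l _ k _ k] BV)
  also have "\<dots> = V * (transpose_mat S * transpose_mat U * (U * S))"
    unfolding BT by (rule assoc_mult_mat[of _ k k _ l _ k]) (use US SU in auto)
  also have "transpose_mat S * transpose_mat U * (U * S) = transpose_mat S * (transpose_mat U * (U * S))"
    by (rule assoc_mult_mat[of _ k l _ l _ k]) (use US in auto)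
  also have "transpose_mat U * (U * S) = transpose_mat U * U * S"
    by (rule assoc_mult_mat[symmetric, of _ l l _ l _ k]) auto
  also have "V * (transpose_mat S * (transpose_mat U * U * S)) = V * mat_diag k (\<lambda>i. (\<theta> i)\<^sup>2)"
    by (simp add: UU SS left_mult_one_mat[of S l k])
  finally show ?thesis using that V by blast
qed

text \<open>A vanishing singular value would contradict injectivity. Two equal ones would give two orthonormal
  eigenvectors of \<open>B\<^sup>T B\<close> for one eigenvalue, and a nontrivial combination of them has first entry \<open>0\<close>.\<close>

lemma bidiagonal_singular_values_distinct:
  assumes a: "\<And>i. i < k \<Longrightarrow> a i \<noteq> 0" and c: "\<And>i. i + 1 < k \<Longrightarrow> c i \<noteq> 0"
    and sv: "is_singular_values (lower_bidiagonal k a c) \<theta>"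
  shows "\<forall>i<k. \<theta> i > 0" and "\<forall>i j. i < j \<longrightarrow> j < k \<longrightarrow> \<theta> j < \<theta> i"
proof -
  let ?B = "lower_bidiagonal k a c"
  have Bd [simp]: "dim_row ?B = k + 1" "dim_col ?B = k"
    using lower_bidiagonal_carrier[of k a c] by (auto simp del: lower_bidiagonal_carrier)
  have nonneg: "\<theta> i \<ge> 0" if "i < k" for i
    using sv that by (simp add: is_singular_values_def)
  have decr: "\<theta> j \<le> \<theta> i" if "i < j" "j < k" for i j
    using sv that by (simp add: is_singular_values_def)
  obtain V where V: "orthonormal_mat k V"
    and diag: "(transpose_mat ?B * ?B) * V = V * mat_diag k (\<lambda>i. (\<theta> i)\<^sup>2)"
    using singular_values_diagonalize_gram[OF lower_bidiagonal_carrier _ sv] by auto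
  have Vc [simp]: "V \<in> carrier_mat k k" and VV: "transpose_mat V * V = 1\<^sub>m k"
    using V by (auto simp: orthonormal_mat_def)
  define v where "v i = col V i" for i
  have v [simp]: "v i \<in> carrier_vec k" for i
    using Vc unfolding v_def by (metis carrier_matD(1) col_carrier_vec col_dim)
  have [simp]: "dim_vec (v i) = k" for i using carrier_vecD[OF v] .
  have orth: "v i \<bullet> v j = (if i = j then 1 else 0)" if "i < k" "j < k" for i j
    using arg_cong[OF VV, of "\<lambda>M. M $$ (i, j)"] that Vc unfolding v_def
    by (simp del: Vc add: carrier_matD[OF Vc])
  have eig: "transpose_mat ?B *\<^sub>v (?B *\<^sub>v v i) = (\<theta> i)\<^sup>2 \<cdot>\<^sub>v v i" if i: "i < k" for i
  proof -
    have "transpose_mat ?B *\<^sub>v (?B *\<^sub>v v i) = (transpose_mat ?B * ?B) *\<^sub>v v i"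
      by (rule assoc_mult_mat_vec[symmetric, of _ k "k + 1" _ k]) auto
    also have "\<dots> = col ((transpose_mat ?B * ?B) * V) i"
      using i Vc unfolding v_def by (subst col_mult2[of _ k k _ k]) (auto intro: mult_carrier_mat[of _ k "k+1"])
    also have "\<dots> = (\<theta> i)\<^sup>2 \<cdot>\<^sub>v v i"
      unfolding diag v_def using i by (auto simp: mat_diag_mult_right[OF Vc] carrier_matD[OF Vc] intro!: eq_vecI)
    finally show ?thesis .
  qed
  have nz: "v i \<noteq> 0\<^sub>v k" if "i < k" for i
    using orth[OF that that] by auto
  have first: "v i $ 0 \<noteq> 0" if "i < k" for i
    using bidiagonal_gram_eigenvector_first_entry[OF a c v eig[OF that]] nz[OF that] by auto
  show pos: "\<forall>i<k. \<theta> i > 0"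
  proof (intro allI impI)
    fix i assume i: "i < k"
    have "\<theta> i \<noteq> 0"
    proof
      assume "\<theta> i = 0"
      then have "transpose_mat ?B *\<^sub>v (?B *\<^sub>v v i) = 0\<^sub>v k"
        using eig[OF i] by (auto intro!: eq_vecI)
      then have "?B *\<^sub>v v i = 0\<^sub>v (k + 1)"
        by (rule transpose_mult_self_kernel[OF lower_bidiagonal_carrier v])
      then have "v i = 0\<^sub>v k" using lower_bidiagonal_injective[where a = a, OF _ v] a by blast
      with nz[OF i] show False ..
    qed
    then show "\<theta> i > 0" using nonneg[OF i] by simp
  qed
  show "\<forall>i j. i < j \<longrightarrow> j < k \<longrightarrow> \<theta> j < \<theta> i"
  proof (intro allI impI)
    fix i j assume ij: "i < j" "j < k"
    have "\<theta> i \<noteq> \<theta> j"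
    proof
      assume eq: "\<theta> i = \<theta> j"
      \<comment> \<open>The combination of the two eigenvectors in which the first entries cancel.\<close>
      let ?x = "v j $ 0 \<cdot>\<^sub>v v i - v i $ 0 \<cdot>\<^sub>v v j"
      have x: "?x \<in> carrier_vec k" by simp
      have lin: "M *\<^sub>v ?x = v j $ 0 \<cdot>\<^sub>v (M *\<^sub>v v i) - v i $ 0 \<cdot>\<^sub>v (M *\<^sub>v v j)"
        if "M \<in> carrier_mat k k" for M
        using that by (simp add: mult_minus_distrib_mat_vec[of _ k k] mult_mat_vec[of _ k k])
      have assoc: "transpose_mat ?B *\<^sub>v (?B *\<^sub>v y) = (transpose_mat ?B * ?B) *\<^sub>v y"
        if "y \<in> carrier_vec k" for y
        by (rule assoc_mult_mat_vec[symmetric, of _ k "k + 1" _ k]) (use that in auto)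
      have "transpose_mat ?B *\<^sub>v (?B *\<^sub>v ?x) = (\<theta> i)\<^sup>2 \<cdot>\<^sub>v ?x"
        unfolding assoc[OF x] lin[OF mult_carrier_mat[OF transpose_carrier_mat[THEN iffD2, OF lower_bidiagonal_carrier] lower_bidiagonal_carrier]]
        using eig[of i] eig[of j] ij eq assoc[OF v]
        by (auto intro!: eq_vecI simp: algebra_simps)
      moreover have "?x $ 0 = 0" using ij by simp
      ultimately have "?x = 0\<^sub>v k"
        using bidiagonal_gram_eigenvector_first_entry[where a = a and c = c, OF _ _ x] a c by blast
      then have "?x \<bullet> v i = 0" by simp
      moreover have "?x \<bullet> v i = v j $ 0"
        using ij by (simp add: minus_scalar_prod_distrib[of _ k] orth)
      ultimately show False using first[of j] ij by simp
    qed
    then show "\<theta> j < \<theta> i" using decr[OF ij] by simp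
  qed
qed

section \<open>The bidiagonalization process\<close>

lemma pgkb_B_lower_bidiagonal:
  "pgkb_B A G b k = lower_bidiagonal k (pgkb_alpha A G b) (\<lambda>j. pgkb_beta A G b (j + 1))"
  by (simp only: pgkb_B_def lower_bidiagonal_def)

definition pgkb_u :: "real mat \<Rightarrow> real mat \<Rightarrow> real vec \<Rightarrow> nat \<Rightarrow> real vec" where
  "pgkb_u A G b i = (case pgkb A G b i of (\<beta>, u, \<alpha>, w) \<Rightarrow> u)"

text \<open>Normalizing and multiplying back also works for the zero vector, where \<open>1 / 0 = 0\<close>. So the
  recurrences of the process stay valid in a step in which it terminates. This matters for the last
  column of \<open>B\<^sub>k\<close>, whose subdiagonal entry may vanish.\<close>

lemma norm_vec2_smult_normalized:
  "v \<in> carrier_vec n \<Longrightarrow> norm_vec2 v \<cdot>\<^sub>v ((1 / norm_vec2 v) \<cdot>\<^sub>v v) = v"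
  by (cases "v = 0\<^sub>v n")
    (auto simp: norm_vec2_def smult_smult_assoc scalar_prod_self_eq_0_iff[of v n])

lemma norm_vecG_smult_normalized:
  assumes "v \<in> carrier_vec n"
    and "\<And>v. v \<in> carrier_vec n \<Longrightarrow> v \<noteq> 0\<^sub>v n \<Longrightarrow> v \<bullet> (G *\<^sub>v v) > 0"
  shows "norm_vecG G v \<cdot>\<^sub>v ((1 / norm_vecG G v) \<cdot>\<^sub>v v) = v"
proof (cases "v = 0\<^sub>v n")
  case False
  then have "norm_vecG G v > 0" using assms by (simp add: norm_vecG_def)
  then show ?thesis by (simp add: smult_smult_assoc)
qed auto

text \<open>The identity \<open>\<langle>B\<^sup>T g, x\<rangle> = \<langle>g, B x\<rangle>\<close> for the bidiagonal matrix \<open>B\<close> with diagonal \<open>a\<close> and subdiagonal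
  \<open>c\<close>. It is also applied to the components of the vectors produced by the process.\<close>

lemma bidiagonal_summation_by_parts:
  fixes a c g x :: "nat \<Rightarrow> real"
  shows "(\<Sum>j<k. (a j * g j + c j * g (j + 1)) * x j) =
    (\<Sum>l<k + 1. g l * ((if l < k then a l * x l else 0) + (if 0 < l then c (l - 1) * x (l - 1) else 0)))"
proof -
  have "(\<Sum>l<k + 1. g l * (if l < k then a l * x l else 0)) = (\<Sum>j<k. a j * g j * x j)"
    by (simp add: mult_ac)
  moreover have "(\<Sum>l<k + 1. g l * (if 0 < l then c (l - 1) * x (l - 1) else 0))
      = (\<Sum>j<k. c j * g (j + 1) * x j)"
    unfolding Suc_eq_plus1[symmetric] sum.lessThan_Suc_shift by (simp add: mult_ac)
  ultimately show ?thesis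
    by (simp add: distrib_left distrib_right sum.distrib del: sum.lessThan_Suc)
qed

context
  fixes A G :: "real mat" and b :: "real vec" and m n :: nat
  assumes A: "A \<in> carrier_mat m n" and b: "b \<in> carrier_vec m"
    and H: "mat_inv G \<in> carrier_mat n n"
    and posdef: "\<And>v. v \<in> carrier_vec n \<Longrightarrow> v \<noteq> 0\<^sub>v n \<Longrightarrow> v \<bullet> (G *\<^sub>v v) > 0"
begin

lemma adjoint_carrier:
  "x \<in> carrier_vec m \<Longrightarrow> mat_inv G *\<^sub>v (transpose_mat A *\<^sub>v x) \<in> carrier_vec n"
  using A H by (intro mult_mat_vec_carrier[of _ n n] mult_mat_vec_carrier[of _ n m]) auto

lemma pgkb_carrier: "pgkb_u A G b i \<in> carrier_vec m" "pgkb_w A G b i \<in> carrier_vec n"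
proof -
  have "pgkb_u A G b i \<in> carrier_vec m \<and> pgkb_w A G b i \<in> carrier_vec n"
  proof (induction i)
    case 0
    then show ?case using A b H by (simp add: pgkb_u_def pgkb_w_def Let_def)
  next
    case (Suc i)
    then show ?case using A b H
      by (cases "pgkb A G b i") (simp add: pgkb_u_def pgkb_w_def Let_def)
  qed
  then show "pgkb_u A G b i \<in> carrier_vec m" "pgkb_w A G b i \<in> carrier_vec n" by auto
qed

lemma pgkb_start:
  "pgkb_beta A G b 0 \<cdot>\<^sub>v pgkb_u A G b 0 = b"
  "pgkb_alpha A G b 0 \<cdot>\<^sub>v pgkb_w A G b 0 = mat_inv G *\<^sub>v (transpose_mat A *\<^sub>v pgkb_u A G b 0)"
proof -
  show "pgkb_beta A G b 0 \<cdot>\<^sub>v pgkb_u A G b 0 = b"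
    using norm_vec2_smult_normalized[OF b] by (simp add: pgkb_beta_def pgkb_u_def Let_def)
  let ?s = "mat_inv G *\<^sub>v (transpose_mat A *\<^sub>v pgkb_u A G b 0)"
  have "?s \<in> carrier_vec n" by (rule adjoint_carrier[OF pgkb_carrier(1)])
  from norm_vecG_smult_normalized[OF this posdef]
  show "pgkb_alpha A G b 0 \<cdot>\<^sub>v pgkb_w A G b 0 = ?s"
    by (simp add: pgkb_alpha_def pgkb_u_def pgkb_w_def Let_def)
qed

lemma pgkb_step_u:
  "A *\<^sub>v pgkb_w A G b i = pgkb_alpha A G b i \<cdot>\<^sub>v pgkb_u A G b i
     + pgkb_beta A G b (Suc i) \<cdot>\<^sub>v pgkb_u A G b (Suc i)"
proof -
  let ?t = "A *\<^sub>v pgkb_w A G b i - pgkb_alpha A G b i \<cdot>\<^sub>v pgkb_u A G b i"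
  have t: "?t \<in> carrier_vec m" using A pgkb_carrier[of i] by simp
  have "pgkb_beta A G b (Suc i) \<cdot>\<^sub>v pgkb_u A G b (Suc i) = ?t"
    using norm_vec2_smult_normalized[OF t]
    by (cases "pgkb A G b i")
      (simp add: pgkb_beta_def pgkb_alpha_def pgkb_u_def pgkb_w_def Let_def)
  then show ?thesis using A pgkb_carrier[of i] by (auto intro!: eq_vecI)
qed

lemma pgkb_step_w:
  "mat_inv G *\<^sub>v (transpose_mat A *\<^sub>v pgkb_u A G b (Suc i)) =
     pgkb_alpha A G b (Suc i) \<cdot>\<^sub>v pgkb_w A G b (Suc i) + pgkb_beta A G b (Suc i) \<cdot>\<^sub>v pgkb_w A G b i"
proof -
  let ?s = "mat_inv G *\<^sub>v (transpose_mat A *\<^sub>v pgkb_u A G b (Suc i))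
    - pgkb_beta A G b (Suc i) \<cdot>\<^sub>v pgkb_w A G b i"
  have s: "?s \<in> carrier_vec n" using adjoint_carrier pgkb_carrier by simp
  have "pgkb_alpha A G b (Suc i) \<cdot>\<^sub>v pgkb_w A G b (Suc i) = ?s"
    using norm_vecG_smult_normalized[OF s posdef]
    by (cases "pgkb A G b i")
      (simp add: pgkb_beta_def pgkb_alpha_def pgkb_u_def pgkb_w_def Let_def)
  then show ?thesis using A H pgkb_carrier[of i] by (auto intro!: eq_vecI)
qed

lemma pgkb_W_mult_vec:
  assumes "v \<in> carrier_vec k" "i < n"
  shows "(pgkb_W A G b k *\<^sub>v v) $ i = (\<Sum>j<k. pgkb_w A G b j $ i * v $ j)"
  using assms A pgkb_carrier
  by (auto simp: pgkb_W_def scalar_prod_def mat_of_cols_def atLeast0LessThan intro!: sum.cong)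

lemma pgkb_W_carrier [simp]: "pgkb_W A G b k \<in> carrier_mat n k"
  using A mat_of_cols_carrier(1)[of n "map (pgkb_w A G b) [0..<k]"] by (simp add: pgkb_W_def)

lemma normal_operator_pgkb_w:
  "mat_inv G *\<^sub>v (transpose_mat A *\<^sub>v (A *\<^sub>v pgkb_w A G b i)) =
     pgkb_alpha A G b i \<cdot>\<^sub>v (mat_inv G *\<^sub>v (transpose_mat A *\<^sub>v pgkb_u A G b i))
     + pgkb_beta A G b (Suc i) \<cdot>\<^sub>v (mat_inv G *\<^sub>v (transpose_mat A *\<^sub>v pgkb_u A G b (Suc i)))"
  using A H pgkb_carrier
  by (simp add: pgkb_step_u mult_add_distrib_mat_vec[of _ n m] mult_add_distrib_mat_vec[of _ n n]
      mult_mat_vec[of _ n m] mult_mat_vec[of _ n n])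

text \<open>The recurrences say \<open>A W\<^sub>k = U\<^sub>k\<^sub>+\<^sub>1 B\<^sub>k\<close> and
  \<open>G\<^sup>-\<^sup>1 A\<^sup>T U\<^sub>k\<^sub>+\<^sub>1 = W\<^sub>k B\<^sub>k\<^sup>T + \<alpha>\<^sub>k\<^sub>+\<^sub>1 w\<^sub>k\<^sub>+\<^sub>1 e\<^sub>k\<^sub>+\<^sub>1\<^sup>T\<close>. Applied to \<open>B\<^sub>k v\<close>, the last term is a multiple of the
  last entry of \<open>B\<^sub>k v\<close>, hence of the last entry of \<open>v\<close>.\<close>

lemma pgkb_W_intertwines:
  assumes v: "v \<in> carrier_vec k" and k: "0 < k" and last: "v $ (k - 1) = 0"
  shows "mat_inv G *\<^sub>v (transpose_mat A *\<^sub>v (A *\<^sub>v (pgkb_W A G b k *\<^sub>v v))) =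
    pgkb_W A G b k *\<^sub>v (transpose_mat (pgkb_B A G b k) *\<^sub>v (pgkb_B A G b k *\<^sub>v v))"
proof (rule eq_vecI)
  let ?a = "pgkb_alpha A G b" and ?c = "\<lambda>j. pgkb_beta A G b (j + 1)"
  let ?B = "lower_bidiagonal k ?a ?c" and ?W = "pgkb_W A G b k"
  let ?h = "\<lambda>l. mat_inv G *\<^sub>v (transpose_mat A *\<^sub>v pgkb_u A G b l)"
  let ?K = "mat_inv G * (transpose_mat A * A)"
  have K: "?K \<in> carrier_mat n n" using A H by simp
  have KW: "?K * ?W \<in> carrier_mat n k" using K by (rule mult_carrier_mat) simp
  fix i assume "i < dim_vec (?W *\<^sub>v (transpose_mat (pgkb_B A G b k) *\<^sub>v (pgkb_B A G b k *\<^sub>v v)))"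
  then have i: "i < n" using carrier_matD[OF pgkb_W_carrier] by simp
  have Bv: "?B *\<^sub>v v \<in> carrier_vec (k + 1)"
    using v lower_bidiagonal_carrier by (rule mult_mat_vec_carrier[rotated])
  have Bv_last: "(?B *\<^sub>v v) $ k = 0"
    using lower_bidiagonal_mult_vec[OF v, of k ?a ?c] last by simp
  have Kw: "(?K * ?W) $$ (i, j) = ?a j * ?h j $ i + ?c j * ?h (j + 1) $ i" if j: "j < k" for j
  proof -
    have "col ?W j = pgkb_w A G b j"
      unfolding pgkb_W_def using j A pgkb_carrier by (subst col_mat_of_cols) auto
    then have "(?K * ?W) $$ (i, j) = (?K *\<^sub>v pgkb_w A G b j) $ i"
      using i j carrier_matD[OF K] carrier_matD[OF pgkb_W_carrier, of k]
      by (simp del: index_mult_mat(2,3))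
    also have "?K *\<^sub>v pgkb_w A G b j = mat_inv G *\<^sub>v (transpose_mat A *\<^sub>v (A *\<^sub>v pgkb_w A G b j))"
      using A H pgkb_carrier(2)[of j]
      by (simp add: assoc_mult_mat_vec[of _ n n _ n] assoc_mult_mat_vec[of _ n m _ n])
    also have "\<dots> = ?a j \<cdot>\<^sub>v ?h j + ?c j \<cdot>\<^sub>v ?h (j + 1)"
      by (simp add: normal_operator_pgkb_w)
    finally show ?thesis using i H by simp
  qed
  have h: "?h l $ i = (if l < k then ?a l * pgkb_w A G b l $ i else 0)
      + (if 0 < l then ?c (l - 1) * pgkb_w A G b (l - 1) $ i else 0)" if "l < k" for l
    using that i pgkb_start(2)[symmetric] pgkb_step_w[of "l - 1"] carrier_vecD[OF pgkb_carrier(2)] by (cases l) auto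
  have "(mat_inv G *\<^sub>v (transpose_mat A *\<^sub>v (A *\<^sub>v (?W *\<^sub>v v)))) $ i = ((?K * ?W) *\<^sub>v v) $ i"
  proof -
    have Wv: "?W *\<^sub>v v \<in> carrier_vec n" using v by (rule mult_mat_vec_carrier[OF pgkb_W_carrier])
    have "?K *\<^sub>v (?W *\<^sub>v v) = mat_inv G *\<^sub>v (transpose_mat A *\<^sub>v (A *\<^sub>v (?W *\<^sub>v v)))"
      using A H Wv
      by (simp add: assoc_mult_mat_vec[of _ n n _ n] assoc_mult_mat_vec[of _ n m _ n])
    then show ?thesis using assoc_mult_mat_vec[OF K pgkb_W_carrier v] by simp
  qed
  also have "\<dots> = (\<Sum>j<k. (?a j * ?h j $ i + ?c j * ?h (j + 1) $ i) * v $ j)"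
    unfolding mult_mat_vec_entry_sum[OF KW v i] by (rule sum.cong) (auto simp only: Kw lessThan_iff)
  also have "\<dots> = (\<Sum>l<k + 1. ?h l $ i * (?B *\<^sub>v v) $ l)"
    unfolding bidiagonal_summation_by_parts[where g = "\<lambda>l. ?h l $ i"]
    by (rule sum.cong) (auto simp: lower_bidiagonal_mult_vec[OF v])
  also have "\<dots> = (\<Sum>l<k + 1. (?B *\<^sub>v v) $ l * ((if l < k then ?a l * pgkb_w A G b l $ i else 0)
      + (if 0 < l then ?c (l - 1) * pgkb_w A G b (l - 1) $ i else 0)))"
    by (rule sum.cong) (use h Bv_last in \<open>auto simp: less_Suc_eq mult.commute\<close>)
  also have "\<dots> = (\<Sum>j<k. (?a j * (?B *\<^sub>v v) $ j + ?c j * (?B *\<^sub>v v) $ (j + 1)) * pgkb_w A G b j $ i)"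
    by (rule bidiagonal_summation_by_parts[symmetric])
  also have "\<dots> = (\<Sum>j<k. pgkb_w A G b j $ i * (transpose_mat ?B *\<^sub>v (?B *\<^sub>v v)) $ j)"
    by (rule sum.cong) (auto simp: lower_bidiagonal_transpose_mult_vec[OF Bv, unfolded Suc_eq_plus1[symmetric]])
  also have "\<dots> = (?W *\<^sub>v (transpose_mat ?B *\<^sub>v (?B *\<^sub>v v))) $ i"
    by (rule pgkb_W_mult_vec[symmetric, OF _ i])
      (rule mult_mat_vec_carrier[OF _ Bv], simp only: transpose_carrier_mat lower_bidiagonal_carrier)
  finally show "(mat_inv G *\<^sub>v (transpose_mat A *\<^sub>v (A *\<^sub>v (?W *\<^sub>v v)))) $ i
      = (?W *\<^sub>v (transpose_mat (pgkb_B A G b k) *\<^sub>v (pgkb_B A G b k *\<^sub>v v))) $ i"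
    by (simp add: pgkb_B_lower_bidiagonal)
qed (use H carrier_matD[OF pgkb_W_carrier] in auto)

text \<open>The \<open>j\<close>-th iterate for the tridiagonal matrix \<open>T\<close> is supported on its first \<open>j\<close> entries. For
  \<open>j < k\<close> its last entry is \<open>0\<close>, and \<open>pgkb_W_intertwines\<close> carries out the next step.\<close>

lemma pgkb_W_richardson:
  assumes k: "0 < k" and j: "j \<le> k"
  defines "T \<equiv> transpose_mat (pgkb_B A G b k) * pgkb_B A G b k"
    and "K \<equiv> mat_inv G * (transpose_mat A * A)"
  shows "pgkb_W A G b k *\<^sub>v richardson T t (s \<cdot>\<^sub>v unit_vec k 0) j =
    richardson K t (s \<cdot>\<^sub>v pgkb_w A G b 0) j"
proof -
  let ?a = "pgkb_alpha A G b" and ?c = "\<lambda>j. pgkb_beta A G b (j + 1)"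
  let ?B = "pgkb_B A G b k" and ?W = "pgkb_W A G b k" and ?e = "s \<cdot>\<^sub>v unit_vec k 0"
  let ?x = "\<lambda>j. richardson T t ?e j"
  have B: "?B \<in> carrier_mat (k + 1) k"
    by (simp only: pgkb_B_lower_bidiagonal lower_bidiagonal_carrier)
  have T: "T \<in> carrier_mat k k" using B unfolding T_def by simp
  have K: "K \<in> carrier_mat n n" using A H unfolding K_def by simp
  have x: "?x j \<in> carrier_vec k" for j using T by simp
  have Bx: "?B *\<^sub>v ?x j \<in> carrier_vec (k + 1)" for j by (rule mult_mat_vec_carrier[OF B x])
  have Tx: "T *\<^sub>v ?x j = transpose_mat ?B *\<^sub>v (?B *\<^sub>v ?x j)" for j
    using assoc_mult_mat_vec[OF transpose_carrier_mat[THEN iffD2, OF B] B x]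
    by (simp add: T_def)
  have Wx: "?W *\<^sub>v ?x j \<in> carrier_vec n" for j by (rule mult_mat_vec_carrier[OF pgkb_W_carrier x])
  have Kx: "K *\<^sub>v (?W *\<^sub>v ?x j) = mat_inv G *\<^sub>v (transpose_mat A *\<^sub>v (A *\<^sub>v (?W *\<^sub>v ?x j)))" for j
    using A H Wx[of j] unfolding K_def
    by (simp add: assoc_mult_mat_vec[of _ n n _ n] assoc_mult_mat_vec[of _ n m _ n])
  have support: "?x j $ i = 0" if "j \<le> i" "i < k" for i j
    using that
  proof (induction j arbitrary: i)
    case 0
    then show ?case by simp
  next
    case (Suc j)
    have Bx0: "(?B *\<^sub>v ?x j) $ l = 0" if "j < l" "l \<le> k" for l
      using lower_bidiagonal_mult_vec[OF x[of j], of l ?a ?c] that Suc.IH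
      by (simp add: pgkb_B_lower_bidiagonal)
    have "(T *\<^sub>v ?x j) $ i = 0"
      using lower_bidiagonal_transpose_mult_vec[OF Bx[of j], of i ?a ?c] Bx0 Suc.prems
      by (simp add: Tx pgkb_B_lower_bidiagonal)
    then show ?case using Suc carrier_vecD[OF x] T by simp
  qed
  have We: "?W *\<^sub>v ?e = s \<cdot>\<^sub>v pgkb_w A G b 0"
  proof (rule eq_vecI)
    fix i assume "i < dim_vec (s \<cdot>\<^sub>v pgkb_w A G b 0)"
    then have i: "i < n" using carrier_vecD[OF pgkb_carrier(2)] by simp
    have "(?W *\<^sub>v ?e) $ i = (\<Sum>j<k. pgkb_w A G b j $ i * ?e $ j)"
      by (rule pgkb_W_mult_vec) (use i in auto)
    also have "\<dots> = (\<Sum>j<k. if j = 0 then pgkb_w A G b j $ i * s else 0)"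
      by (rule sum.cong) auto
    finally show "(?W *\<^sub>v ?e) $ i = (s \<cdot>\<^sub>v pgkb_w A G b 0) $ i"
      using k i carrier_vecD[OF pgkb_carrier(2)] by simp
  qed (use carrier_matD[OF pgkb_W_carrier] carrier_vecD[OF pgkb_carrier(2)] in auto)
  show ?thesis using j
  proof (induction j)
    case 0
    show ?case using pgkb_carrier(2)[of 0] carrier_matD[OF pgkb_W_carrier]
      by (auto intro!: eq_vecI simp: scalar_prod_def)
  next
    case (Suc j)
    have "?W *\<^sub>v (T *\<^sub>v ?x j) = K *\<^sub>v (?W *\<^sub>v ?x j)"
      unfolding Kx Tx using support[of j "k - 1"] Suc.prems k
      by (intro pgkb_W_intertwines[symmetric] x) auto
    moreover have "?W *\<^sub>v ?x (Suc j)
        = ?W *\<^sub>v ?x j + (1 / t j) \<cdot>\<^sub>v (?W *\<^sub>v ?e - ?W *\<^sub>v (T *\<^sub>v ?x j))"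
      using x[of j] T mult_mat_vec_carrier[OF T x, of j]
      by (simp add: mult_add_distrib_mat_vec[OF pgkb_W_carrier] mult_mat_vec[OF pgkb_W_carrier]
          mult_minus_distrib_mat_vec[OF pgkb_W_carrier])
    ultimately show ?case using Suc We by simp
  qed
qed

end

section \<open>Inverses and diagonalizations\<close>

lemma full_rank_trivial_kernel:
  fixes A :: "real mat"
  assumes A: "A \<in> carrier_mat m n" and rank: "vec_space.rank m A = n"
    and v: "v \<in> carrier_vec n" and 0: "A *\<^sub>v v = 0\<^sub>v m"
  shows "v = 0\<^sub>v n"
proof (rule ccontr)
  interpret vec_space "TYPE(real)" m .
  assume nz: "v \<noteq> 0\<^sub>v n"
  have dist: "distinct (cols A)"
  proof -
    obtain S where S: "maximal S (\<lambda>T. T \<subseteq> set (cols A) \<and> lin_indpt T)"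
      using maximal_exists[of "\<lambda>T. T \<subseteq> set (cols A) \<and> lin_indpt T" "card (set (cols A))" "{}"]
      by (meson List.finite_set card_mono empty_iff empty_subsetI finite_lin_indpt2 rev_finite_subset)
    have "n = card S" using rank_card_indpt[OF A S] rank by simp
    also have "\<dots> \<le> card (set (cols A))" using S by (simp add: card_mono maximal_def)
    finally show ?thesis using A card_length[of "cols A"] by (intro card_distinct) auto
  qed
  from nz dist have "lin_dep (set (cols A))" using lin_depI[OF A v _ 0] by blast
  then show False using full_rank_lin_indpt[OF A rank dist] by blast
qed

lemma mat_inv_eqI:
  assumes X: "X \<in> carrier_mat n n" and Y: "Y \<in> carrier_mat n n" and XY: "X * Y = 1\<^sub>m n"
  shows "mat_inv X = Y"
proof -
  have YX: "Y * X = 1\<^sub>m n" by (rule mat_mult_left_right_inverse[OF X Y XY])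
  have "mat_inverse X \<noteq> None"
    using mat_inverse(1)[OF X, of n] X Y XY YX
    by (auto simp: Units_def ring_mat_def)
  then obtain B where B: "mat_inverse X = Some B" by auto
  then have Bc: "B \<in> carrier_mat n n" and BX: "B * X = 1\<^sub>m n" using mat_inverse(2)[OF X] by auto
  have "B = B * (X * Y)" using XY Bc by simp
  also have "\<dots> = Y" using assoc_mult_mat[OF Bc X Y] BX Y by simp
  finally show ?thesis using B by (simp add: mat_inv_def)
qed

lemma mat_inv_invertible:
  assumes X: "X \<in> carrier_mat n n" and inv: "invertible_mat X"
  shows "mat_inv X \<in> carrier_mat n n" "X * mat_inv X = 1\<^sub>m n" "mat_inv X * X = 1\<^sub>m n"
proof -
  obtain B where B: "X * B = 1\<^sub>m n" "B * X = 1\<^sub>m (dim_row B)"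
    using inv X by (auto simp: invertible_mat_def inverts_mat_def)
  have "dim_col B = n" using arg_cong[OF B(1), of dim_col] by simp
  moreover have "dim_row B = n" using arg_cong[OF B(2), of dim_col] X by simp
  ultimately have Bc: "B \<in> carrier_mat n n" by auto
  have "mat_inv X = B" by (rule mat_inv_eqI[OF X Bc B(1)])
  then show "mat_inv X \<in> carrier_mat n n" "X * mat_inv X = 1\<^sub>m n" "mat_inv X * X = 1\<^sub>m n"
    using B Bc by auto
qed

text \<open>Both functions list the same multiset of values in sorted order.\<close>

lemma antimono_eq_of_permutes:
  fixes f g :: "nat \<Rightarrow> real"
  assumes p: "p permutes {0..<n}" and fg: "\<And>i. i < n \<Longrightarrow> f i = g (p i)"
    and f: "\<And>i j. i \<le> j \<Longrightarrow> j < n \<Longrightarrow> f j \<le> f i"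
    and g: "\<And>i j. i \<le> j \<Longrightarrow> j < n \<Longrightarrow> g j \<le> g i"
    and i: "i < n"
  shows "f i = g i"
proof -
  let ?l = "\<lambda>h :: nat \<Rightarrow> real. rev (map h [0..<n])"
  have sorted: "sorted (?l h)" if "\<And>i j. i \<le> j \<Longrightarrow> j < n \<Longrightarrow> h j \<le> h i" for h
    using that by (auto simp: sorted_iff_nth_mono rev_nth)
  have "mset (?l f) = image_mset (g \<circ> p) (mset_set {0..<n})"
    using fg by (auto intro!: image_mset_cong)
  also have "\<dots> = image_mset g (image_mset p (mset_set {0..<n}))"
    by (simp add: multiset.map_comp)
  also have "image_mset p (mset_set {0..<n}) = mset_set {0..<n}"
    using p by (simp add: image_mset_mset_set permutes_inj_on permutes_image)
  finally have "mset (?l f) = mset (?l g)" by simp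
  then have "?l f = ?l g"
    using sorted[OF f] sorted[OF g] properties_for_sort[of "?l f" "?l g"] sorted_sort_id[of "?l g"]
    by simp
  then show ?thesis using i by (auto simp: map_eq_conv)
qed

text \<open>The change of basis \<open>T = Z\<^sup>-\<^sup>1 X\<close> between the two eigenbases satisfies
  \<open>diag(\<mu>) T = T diag(\<xi>)\<close>, so \<open>\<mu> i = \<xi> j\<close> wherever \<open>T\<close> has a nonzero entry \<open>(i, j)\<close>. As \<open>det T \<noteq> 0\<close>, the
  Leibniz formula has a nonzero term, and this term provides a permutation along which the
  eigenvalues agree.\<close>

lemma diagonalization_unique:
  fixes N X Z :: "real mat"
  assumes N: "N \<in> carrier_mat n n" and X: "X \<in> carrier_mat n n" and Z: "Z \<in> carrier_mat n n"
    and invX: "invertible_mat X" and invZ: "invertible_mat Z"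
    and NX: "N * X = X * mat_diag n \<xi>" and NZ: "N * Z = Z * mat_diag n \<mu>"
    and \<xi>: "\<And>i j. i \<le> j \<Longrightarrow> j < n \<Longrightarrow> \<xi> j \<le> \<xi> i"
    and \<mu>: "\<And>i j. i \<le> j \<Longrightarrow> j < n \<Longrightarrow> \<mu> j \<le> \<mu> i"
    and i: "i < n"
  shows "\<mu> i = \<xi> i"
proof -
  define T where "T = mat_inv Z * X"
  note Zi = mat_inv_invertible[OF Z invZ] and Xi = mat_inv_invertible[OF X invX]
  note assoc = assoc_mult_mat[of _ n n _ n _ n]
  have T: "T \<in> carrier_mat n n" unfolding T_def using Zi(1) X by simp
  have ZT: "Z * T = X" unfolding T_def using Zi X Z by (simp add: assoc[symmetric])
  have "(mat_inv X * Z) * T = 1\<^sub>m n" using ZT Zi Xi X Z T by (simp add: assoc)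
  then have "det (mat_inv X * Z) * det T = 1"
    using det_mult[of "mat_inv X * Z" n T] Xi Z T by simp
  then have det: "det T \<noteq> 0" by auto
  have "mat_diag n \<mu> * T = mat_inv Z * (Z * mat_diag n \<mu>) * T"
    using Zi Z by (simp add: assoc[symmetric] left_mult_one_mat[of _ n n])
  also have "\<dots> = mat_inv Z * (N * X)"
    unfolding NZ[symmetric] using Zi Z N T by (simp add: assoc ZT)
  also have "\<dots> = T * mat_diag n \<xi>"
    unfolding NX T_def using Zi X by (simp add: assoc)
  finally have comm: "mat_diag n \<mu> * T = T * mat_diag n \<xi>" .
  have entry: "\<mu> i * T $$ (i, j) = T $$ (i, j) * \<xi> j" if "i < n" "j < n" for i j
    using arg_cong[OF comm, of "\<lambda>M. M $$ (i, j)"] that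
    by (simp add: mat_diag_mult_left[OF T] mat_diag_mult_right[OF T])
  have "\<exists>p. p permutes {0..<n} \<and> (\<Prod>i = 0..<n. T $$ (i, p i)) \<noteq> 0"
  proof (rule ccontr)
    assume "\<not> ?thesis"
    then have "det T = 0" unfolding det_def'[OF T] by (intro sum.neutral) auto
    with det show False ..
  qed
  then obtain p where p: "p permutes {0..<n}" and nz: "(\<Prod>i = 0..<n. T $$ (i, p i)) \<noteq> 0" by blast
  have "\<mu> j = \<xi> (p j)" if "j < n" for j
  proof -
    have "T $$ (j, p j) \<noteq> 0" using nz that by auto
    moreover have "p j < n" using permutes_in_image[OF p, of j] that by simp
    ultimately show ?thesis using entry[OF that, of "p j"] by simp
  qed
  then show ?thesis using antimono_eq_of_permutes[where f = \<mu> and g = \<xi>, OF p _ _ _ i] \<mu> \<xi> by blast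
qed

lemma orthogonal_factor_gram:
  fixes U D Y :: "real mat"
  assumes U: "orthonormal_mat l U" and D: "D \<in> carrier_mat l n" and Y: "Y \<in> carrier_mat n n"
  shows "transpose_mat (U * D * Y) * (U * D * Y) = transpose_mat Y * (transpose_mat D * D) * Y"
proof -
  have Uc: "U \<in> carrier_mat l l" and UU: "transpose_mat U * U = 1\<^sub>m l"
    using U by (auto simp: orthonormal_mat_def)
  have UD: "U * D \<in> carrier_mat l n" using Uc D by (rule mult_carrier_mat)
  have DD: "transpose_mat D * D \<in> carrier_mat n n" using D by (intro mult_carrier_mat[of _ n l]) auto
  have "transpose_mat (U * D) * (U * D) = transpose_mat D * transpose_mat U * (U * D)"
    by (simp add: transpose_mult[OF Uc D])
  also have "\<dots> = transpose_mat D * (transpose_mat U * (U * D))"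
    by (rule assoc_mult_mat[of _ n l _ l _ n]) (use Uc D UD in auto)
  also have "transpose_mat U * (U * D) = D"
    using assoc_mult_mat[of "transpose_mat U" l l U l D n] Uc D UU by simp
  finally have gram: "transpose_mat (U * D) * (U * D) = transpose_mat D * D" .
  have "transpose_mat (U * D * Y) * (U * D * Y) = transpose_mat Y * transpose_mat (U * D) * (U * D * Y)"
    by (simp add: transpose_mult[OF UD Y])
  also have "\<dots> = transpose_mat Y * (transpose_mat (U * D) * (U * D * Y))"
    by (rule assoc_mult_mat[of _ n n _ l _ n]) (use UD Y in auto)
  also have "transpose_mat (U * D) * (U * D * Y) = transpose_mat D * D * Y"
    unfolding gram[symmetric]
    by (rule assoc_mult_mat[symmetric, of _ n l _ n _ n]) (use UD Y in auto)
  also have "transpose_mat Y * \<dots> = transpose_mat Y * (transpose_mat D * D) * Y"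
    by (rule assoc_mult_mat[symmetric, of _ n n _ n _ n]) (use DD Y in auto)
  finally show ?thesis .
qed

text \<open>Both diagonal factors of a generalized singular value decomposition have at most one nonzero entry
  in each row and column, at positions given by a matching \<open>R\<close> between rows and columns.\<close>

lemma matching_gram:
  fixes D :: "real mat"
  assumes D: "D \<in> carrier_mat l n"
    and entry: "\<And>i j. i < l \<Longrightarrow> j < n \<Longrightarrow> D $$ (i, j) = (if R i j then d j else 0)"
    and row: "\<And>i j j'. R i j \<Longrightarrow> R i j' \<Longrightarrow> j = j'"
    and col: "\<And>i i' j. R i j \<Longrightarrow> R i' j \<Longrightarrow> i = i'"
    and ex: "\<And>j. j < n \<Longrightarrow> d j \<noteq> 0 \<Longrightarrow> \<exists>i<l. R i j"
  shows "transpose_mat D * D = mat_diag n (\<lambda>j. (d j)\<^sup>2)"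
proof (rule eq_matI)
  fix i j assume "i < dim_row (mat_diag n (\<lambda>j. (d j)\<^sup>2))" "j < dim_col (mat_diag n (\<lambda>j. (d j)\<^sup>2))"
  then have ij: "i < n" "j < n" by (auto simp: mat_diag_def)
  then have "(transpose_mat D * D) $$ (i, j)
      = (\<Sum>h = 0..<l. (if R h i then d i else 0) * (if R h j then d j else 0))"
    using D by (auto simp: scalar_prod_def entry intro!: sum.cong)
  also have "\<dots> = (if i = j then (d j)\<^sup>2 else 0)"
  proof (cases "i = j \<and> d j \<noteq> 0")
    case True
    then obtain h where h: "h < l" "R h j" using ex ij by blast
    have "(\<Sum>h = 0..<l. (if R h i then d i else 0) * (if R h j then d j else 0))
        = (\<Sum>h' = 0..<l. if h' = h then (d j)\<^sup>2 else 0)"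
      by (rule sum.cong) (use True h col in \<open>auto simp: power2_eq_square\<close>)
    then show ?thesis using h True by simp
  next
    case False
    then show ?thesis using row by (intro sum.neutral[THEN trans]) auto
  qed
  finally show "(transpose_mat D * D) $$ (i, j) = mat_diag n (\<lambda>j. (d j)\<^sup>2) $$ (i, j)"
    using ij by (simp add: mat_diag_def)
qed (use D in \<open>auto simp: mat_diag_def\<close>)

lemma diagonal_congruence_inverse:
  fixes Z :: "real mat"
  assumes Z: "Z \<in> carrier_mat n n" and inv: "invertible_mat Z" and d: "\<And>i. i < n \<Longrightarrow> d i > 0"
  defines "G \<equiv> transpose_mat (mat_inv Z) * mat_diag n d * mat_inv Z"
  shows "mat_inv G = Z * mat_diag n (\<lambda>i. 1 / d i) * transpose_mat Z"
proof (rule mat_inv_eqI)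
  let ?Y = "mat_inv Z" and ?E = "mat_diag n (\<lambda>i. 1 / d i)"
  note Y = mat_inv_invertible[OF Z inv]
  note assoc = assoc_mult_mat[of _ n n _ n _ n]
  show "G \<in> carrier_mat n n" "Z * ?E * transpose_mat Z \<in> carrier_mat n n"
    unfolding G_def using Y(1) Z by (simp_all add: mult_carrier_mat[of _ n n _ n])
  have DE: "mat_diag n d * ?E = 1\<^sub>m n"
    unfolding mat_diag_diag
    by (rule eq_matI) (use d in \<open>auto simp: mat_diag_def dest: less_imp_neq[symmetric]\<close>)
  have YZ: "transpose_mat ?Y * transpose_mat Z = 1\<^sub>m n"
    using transpose_mult[OF Z Y(1)] Y(2) by simp
  have "G * (Z * ?E * transpose_mat Z) = transpose_mat ?Y * mat_diag n d * (?Y * Z) * ?E * transpose_mat Z"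
    unfolding G_def using Y(1) Z by (simp add: assoc mult_carrier_mat[of _ n n _ n])
  also have "\<dots> = transpose_mat ?Y * (mat_diag n d * ?E) * transpose_mat Z"
    unfolding Y(3) using Y(1) Z
    by (simp add: assoc mult_carrier_mat[of _ n n _ n] left_mult_one_mat[of _ n n] del: mat_diag_diag)
  also have "\<dots> = 1\<^sub>m n"
    unfolding DE using Y(1) YZ by simp
  finally show "G * (Z * ?E * transpose_mat Z) = 1\<^sub>m n" .
qed

lemma diagonal_congruence_posdef:
  fixes Z :: "real mat"
  assumes Z: "Z \<in> carrier_mat n n" and inv: "invertible_mat Z" and d: "\<And>i. i < n \<Longrightarrow> d i > 0"
    and v: "v \<in> carrier_vec n" "v \<noteq> 0\<^sub>v n"
  shows "v \<bullet> ((transpose_mat (mat_inv Z) * mat_diag n d * mat_inv Z) *\<^sub>v v) > 0"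
proof -
  let ?Y = "mat_inv Z"
  note Y = mat_inv_invertible[OF Z inv]
  define x where "x = ?Y *\<^sub>v v"
  have x: "x \<in> carrier_vec n" unfolding x_def using Y v by simp
  have Dx: "mat_diag n d *\<^sub>v x \<in> carrier_vec n" by (rule mult_mat_vec_carrier[OF _ x]) simp
  have Yt: "transpose_mat ?Y \<in> carrier_mat n n" using Y(1) by simp
  have "(transpose_mat ?Y * mat_diag n d * ?Y) *\<^sub>v v = transpose_mat ?Y *\<^sub>v (mat_diag n d *\<^sub>v x)"
    unfolding x_def using Y(1) v Yt
    by (simp add: assoc_mult_mat_vec[of _ n n _ n] mult_carrier_mat[of _ n n _ n])
  then have "v \<bullet> ((transpose_mat ?Y * mat_diag n d * ?Y) *\<^sub>v v) = (mat_diag n d *\<^sub>v x) \<bullet> x"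
    using transpose_vec_mult_scalar[OF Y(1) v(1) Dx] comm_scalar_prod[OF v(1), of "transpose_mat ?Y *\<^sub>v (mat_diag n d *\<^sub>v x)"]
      mult_mat_vec_carrier[OF Yt Dx] by (simp add: x_def)
  also have "\<dots> = (\<Sum>i<n. d i * (x $ i)\<^sup>2)"
    unfolding mat_diag_mult_vec[OF x] using x
    by (auto simp: scalar_prod_def atLeast0LessThan power2_eq_square intro!: sum.cong)
  also have "\<dots> > 0"
  proof -
    have "x \<noteq> 0\<^sub>v n"
    proof
      assume "x = 0\<^sub>v n"
      then have "Z *\<^sub>v x = 0\<^sub>v n" using Z by auto
      moreover have "Z *\<^sub>v x = v"
        unfolding x_def using assoc_mult_mat_vec[OF Z Y(1) v(1)] Y(2) v by simp
      ultimately show False using v by simp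
    qed
    then obtain i where "i < n" "x $ i \<noteq> 0" using x by (metis carrier_vecD eq_vecI index_zero_vec)
    then show ?thesis using d by (intro sum_pos2[of _ i]) (auto intro!: mult_nonneg_nonneg intro: less_imp_le)
  qed
  finally show ?thesis .
qed

section \<open>The generalized singular value decomposition\<close>

lemma gsvd_A_blocks_entry:
  fixes \<sigma> :: "nat \<Rightarrow> real"
  assumes "r + q \<le> m" "r + q \<le> n"
  defines "D \<equiv> diag_block_mat [1\<^sub>m r, mat_diag q (\<lambda>i. \<sigma> (r + i)), 0\<^sub>m (m - r - q) (n - r - q)] :: real mat"
  shows "D \<in> carrier_mat m n"
    and "\<lbrakk>i < m; j < n\<rbrakk> \<Longrightarrow> D $$ (i, j) =
      (if i = j then (if j < r then 1 else if j < r + q then \<sigma> j else 0) else 0)"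
  using assms by (auto simp: D_def Let_def mat_diag_def)

text \<open>The nonzero entries lie on the diagonal that ends in the lower right corner. Its equation
  \<open>i + n = j + p\<close> avoids truncated subtraction.\<close>

lemma gsvd_L_blocks_entry:
  fixes \<rho> :: "nat \<Rightarrow> real"
  assumes "r + q \<le> n" "n \<le> p + r"
  defines "D \<equiv> diag_block_mat [0\<^sub>m (p + r - n) r, mat_diag q (\<lambda>i. \<rho> (r + i)), 1\<^sub>m (n - r - q)] :: real mat"
  shows "D \<in> carrier_mat p n"
    and "\<lbrakk>i < p; j < n\<rbrakk> \<Longrightarrow> D $$ (i, j) =
      (if i + n = j + p then (if j < r then 0 else if j < r + q then \<rho> j else 1) else 0)"
proof -
  define a s where "a = p + r - n" and "s = n - r - q"
  have n: "n = r + q + s" and p: "p = a + q + s" using assms(1,2) by (auto simp: a_def s_def)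
  have D: "D = four_block_mat (0\<^sub>m a r) (0\<^sub>m a (q + s)) (0\<^sub>m (q + s) r)
      (four_block_mat (mat_diag q (\<lambda>i. \<rho> (r + i))) (0\<^sub>m q s) (0\<^sub>m s q) (1\<^sub>m s))"
    unfolding D_def a_def[symmetric] s_def[symmetric] diag_block_mat.simps(2)[of _ "_ # _"]
      diag_block_mat_singleton Let_def by (simp add: mat_diag_def)
  show "D \<in> carrier_mat p n" unfolding D n p by (auto simp: mat_diag_def)
  assume i: "i < p" and j: "j < n"
  have "D $$ (i, j) = (if i < a \<or> j < r then 0 else if i - a < q then
      (if j - r < q \<and> i - a = j - r then \<rho> j else 0) else
      (if j - r < q then 0 else if i - a = j - r then 1 else 0))"
    using i j unfolding D n p by (auto simp: mat_diag_def)
  also have "\<dots> = (if i + n = j + p then (if j < r then 0 else if j < r + q then \<rho> j else 1) else 0)"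
  proof (cases "i < a \<or> j < r")
    case True
    then show ?thesis using i j unfolding n p by auto
  next
    case False
    define i' j' where "i' = i - a" and "j' = j - r"
    have "i = a + i'" "j = r + j'" using False by (auto simp: i'_def j'_def)
    then show ?thesis unfolding n p by auto
  qed
  finally show "D $$ (i, j) = (if i + n = j + p then (if j < r then 0 else if j < r + q then \<rho> j else 1) else 0)" .
qed

text \<open>If \<open>r + q < n\<close>, then the last column of \<open>D\<^sub>A\<close> is zero, so \<open>A\<close> maps the last column of \<open>Z\<close> to zero.\<close>

lemma gsvd_full_column_rank:
  assumes gsvd: "is_gsvd A L m n p r q U\<^sub>A U\<^sub>L Z \<sigma> \<rho>"
    and A: "A \<in> carrier_mat m n" and rank: "vec_space.rank m A = n"
  shows "r + q = n"
proof (rule ccontr)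
  define D where "D = (diag_block_mat [1\<^sub>m r, mat_diag q (\<lambda>i. \<sigma> (r + i)), 0\<^sub>m (m - r - q) (n - r - q)] :: real mat)"
  assume "r + q \<noteq> n"
  with gsvd have less: "r + q < n" "r + q \<le> m" and Z: "Z \<in> carrier_mat n n" "invertible_mat Z"
    and U: "U\<^sub>A \<in> carrier_mat m m" and Aeq: "A = U\<^sub>A * D * mat_inv Z"
    by (auto simp: is_gsvd_def orthonormal_mat_def D_def)
  note Y = mat_inv_invertible[OF Z]
  note D_props = gsvd_A_blocks_entry[where r = r and q = q and m = m and n = n and \<sigma> = \<sigma>, folded D_def]
  have Dc: "D \<in> carrier_mat m n" using D_props(1) less by simp
  define e :: "real vec" where "e = unit_vec n (n - 1)"
  have e: "e \<in> carrier_vec n" by (simp add: e_def)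
  have De: "D *\<^sub>v e = 0\<^sub>v m"
  proof (rule eq_vecI)
    fix i assume "i < dim_vec (0\<^sub>v m :: real vec)"
    then have i: "i < m" by simp
    have "(D *\<^sub>v e) $ i = (\<Sum>j<n. D $$ (i, j) * e $ j)"
      by (rule mult_mat_vec_entry_sum[OF Dc e i])
    also have "\<dots> = 0"
      using less by (intro sum.neutral) (auto simp: D_props(2) i e_def)
    finally show "(D *\<^sub>v e) $ i = 0\<^sub>v m $ i" using i by simp
  qed (use Dc in simp)
  have UD: "U\<^sub>A * D \<in> carrier_mat m n" by (rule mult_carrier_mat[OF U Dc])
  have Ze: "Z *\<^sub>v e \<in> carrier_vec n" using Z e by simp
  have YZe: "mat_inv Z *\<^sub>v (Z *\<^sub>v e) = e"
    using assoc_mult_mat_vec[OF Y(1) Z(1) e] Y(3) e by simp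
  have "A *\<^sub>v (Z *\<^sub>v e) = U\<^sub>A *\<^sub>v (D *\<^sub>v e)"
    unfolding Aeq assoc_mult_mat_vec[OF UD Y(1) Ze] YZe by (rule assoc_mult_mat_vec[OF U Dc e])
  also have "\<dots> = 0\<^sub>v m" unfolding De using U by auto
  finally have "Z *\<^sub>v e = 0\<^sub>v n" by (rule full_rank_trivial_kernel[OF A rank Ze])
  then have "e = 0\<^sub>v n" using YZe Y(1) by auto
  then have "e $ (n - 1) = 0" using less by simp
  then show False using less by (simp add: e_def)
qed

text \<open>With \<open>Y = Z\<^sup>-\<^sup>1\<close> the decomposition gives \<open>A\<^sup>T A = Y\<^sup>T diag(\<sigma>\<^sub>i\<^sup>2) Y\<close> and
  \<open>L\<^sup>T L = Y\<^sup>T diag(\<rho>\<^sub>i\<^sup>2) Y\<close>, where \<open>\<rho>\<^sub>i\<close> is read as \<open>0\<close> for \<open>i < r\<close>. So \<open>Z\<close> diagonalizes \<open>A\<^sup>T A\<close> and \<open>G\<close>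
  simultaneously, and \<open>\<mu>\<close> consists of the quotients of their diagonal entries. In the last claim,
  \<open>\<mu>\<close> decreases because \<open>\<sigma>\<close> decreases and \<open>\<rho>\<close> increases.\<close>

lemma gsvd_normal_operator:
  assumes gsvd: "is_gsvd A L m n p r q U\<^sub>A U\<^sub>L Z \<sigma> \<rho>" and rq: "r + q = n"
    and sigma_one: "\<And>i. i < r \<Longrightarrow> \<sigma> i = 1"
    and alpha: "\<alpha> > 0" and b: "b \<in> carrier_vec m"
  defines "G \<equiv> transpose_mat A * A + \<alpha> \<cdot>\<^sub>m (transpose_mat L * L)"
    and "\<mu> \<equiv> \<lambda>i. if i < r then 1 else (\<sigma> i)\<^sup>2 / ((\<sigma> i)\<^sup>2 + \<alpha> * (\<rho> i)\<^sup>2)"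
  shows "mat_inv G \<in> carrier_mat n n" and "mat_inv G * G = 1\<^sub>m n"
    and "\<And>v. v \<in> carrier_vec n \<Longrightarrow> v \<noteq> 0\<^sub>v n \<Longrightarrow> v \<bullet> (G *\<^sub>v v) > 0"
    and "mat_inv G * (transpose_mat A * A) * Z = Z * mat_diag n \<mu>"
    and "mat_inv G *\<^sub>v (transpose_mat A *\<^sub>v b) = Z *\<^sub>v vec n (\<lambda>i. \<mu> i * ((col U\<^sub>A i \<bullet> b) / \<sigma> i))"
    and "\<And>i j. i \<le> j \<Longrightarrow> j < n \<Longrightarrow> \<mu> j \<le> \<mu> i"
proof -
  define DA where "DA = (diag_block_mat [1\<^sub>m r, mat_diag q (\<lambda>i. \<sigma> (r + i)), 0\<^sub>m (m - r - q) (n - r - q)] :: real mat)"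
  define DL where "DL = (diag_block_mat [0\<^sub>m (p + r - n) r, mat_diag q (\<lambda>i. \<rho> (r + i)), 1\<^sub>m (n - r - q)] :: real mat)"
  define \<rho>' where "\<rho>' i = (if i < r then 0 else \<rho> i)" for i
  define d where "d i = (\<sigma> i)\<^sup>2 + \<alpha> * (\<rho>' i)\<^sup>2" for i
  let ?Y = "mat_inv Z"
  have le: "n \<le> m" "n \<le> p + r" and UA: "orthonormal_mat m U\<^sub>A" and UL: "orthonormal_mat p U\<^sub>L"
    and Z: "Z \<in> carrier_mat n n" "invertible_mat Z"
    and Aeq: "A = U\<^sub>A * DA * ?Y" and Leq: "L = U\<^sub>L * DL * ?Y"
    and pos: "\<And>i. r \<le> i \<Longrightarrow> i < n \<Longrightarrow> 0 < \<sigma> i \<and> \<sigma> i < 1 \<and> 0 < \<rho> i"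
    and mono: "\<And>i j. r \<le> i \<Longrightarrow> i \<le> j \<Longrightarrow> j < n \<Longrightarrow> \<sigma> j \<le> \<sigma> i \<and> \<rho> i \<le> \<rho> j"
    using gsvd rq unfolding is_gsvd_def DA_def DL_def by auto
  note Y = mat_inv_invertible[OF Z]
  have sigma_pos: "\<sigma> i > 0" if "i < n" for i
    using pos[of i] sigma_one[of i] that by (cases "i < r") auto
  have d: "d i > 0" if "i < n" for i
    using sigma_pos[OF that] alpha by (auto simp: d_def intro!: add_pos_nonneg)
  have mu: "\<mu> i = (\<sigma> i)\<^sup>2 / d i" for i
    by (simp add: \<mu>_def d_def \<rho>'_def sigma_one)
  have DA: "DA \<in> carrier_mat m n"
    and DA_entry: "\<And>i j. i < m \<Longrightarrow> j < n \<Longrightarrow> DA $$ (i, j) = (if i = j then \<sigma> j else 0)"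
    using gsvd_A_blocks_entry[where r = r and q = q and m = m and n = n and \<sigma> = \<sigma>] le rq sigma_one unfolding DA_def by auto
  have DL: "DL \<in> carrier_mat p n"
    and DL_entry: "\<And>i j. i < p \<Longrightarrow> j < n \<Longrightarrow> DL $$ (i, j) = (if i + n = j + p then \<rho>' j else 0)"
    using gsvd_L_blocks_entry[where r = r and q = q and n = n and p = p and \<rho> = \<rho>] le rq unfolding DL_def \<rho>'_def by auto
  have DDA: "transpose_mat DA * DA = mat_diag n (\<lambda>i. (\<sigma> i)\<^sup>2)"
    by (rule matching_gram[where R = "\<lambda>i j. i = j", OF DA DA_entry]) (use le in auto)
  have DDL: "transpose_mat DL * DL = mat_diag n (\<lambda>i. (\<rho>' i)\<^sup>2)"
  proof (rule matching_gram[where R = "\<lambda>i j. i + n = j + p", OF DL DL_entry])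
    fix j assume "j < n" "\<rho>' j \<noteq> 0"
    then have "r \<le> j" by (auto simp: \<rho>'_def split: if_splits)
    then show "\<exists>i<p. i + n = j + p"
      using le \<open>j < n\<close> by (intro exI[of _ "j + p - n"]) auto
  qed auto
  have AA: "transpose_mat A * A = transpose_mat ?Y * mat_diag n (\<lambda>i. (\<sigma> i)\<^sup>2) * ?Y"
    unfolding Aeq orthogonal_factor_gram[OF UA DA Y(1)] DDA ..
  have LL: "transpose_mat L * L = transpose_mat ?Y * mat_diag n (\<lambda>i. (\<rho>' i)\<^sup>2) * ?Y"
    unfolding Leq orthogonal_factor_gram[OF UL DL Y(1)] DDL ..
  note assoc = assoc_mult_mat[of _ n n _ n _ n] and mc = mult_carrier_mat[of _ n n _ n]
  have Yt: "transpose_mat ?Y \<in> carrier_mat n n" and Zt: "transpose_mat Z \<in> carrier_mat n n"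
    using Y(1) Z by auto
  have Geq: "G = transpose_mat ?Y * mat_diag n d * ?Y"
  proof -
    have "mat_diag n d = mat_diag n (\<lambda>i. (\<sigma> i)\<^sup>2) + \<alpha> \<cdot>\<^sub>m mat_diag n (\<lambda>i. (\<rho>' i)\<^sup>2)"
      by (rule eq_matI) (auto simp: mat_diag_def d_def)
    then show ?thesis
      unfolding G_def AA LL using Y(1) Yt
      by (simp add: mult_add_distrib_mat[of _ n n _ n] add_mult_distrib_mat[of _ n n _ _ n] mc
          mult_smult_distrib[of _ n n _ n] mult_smult_assoc_mat[of _ n n _ n])
  qed
  let ?E = "mat_diag n (\<lambda>i. 1 / d i)"
  have Gi: "mat_inv G = Z * ?E * transpose_mat Z"
    unfolding Geq by (rule diagonal_congruence_inverse[OF Z d])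
  have Gc: "G \<in> carrier_mat n n" unfolding Geq using Y(1) Yt by (simp add: mc)
  show Gic: "mat_inv G \<in> carrier_mat n n" unfolding Gi using Z Zt by (simp add: mc)
  have ZY: "transpose_mat Z * transpose_mat ?Y = 1\<^sub>m n"
    using transpose_mult[OF Y(1) Z(1)] Y(3) by simp
  have ZYx: "transpose_mat Z * (transpose_mat ?Y * X) = X" if "X \<in> carrier_mat n k" for X k
    using assoc_mult_mat[OF Zt Yt that] ZY that by simp
  have Gi_cong: "mat_inv G * (transpose_mat ?Y * mat_diag n c * ?Y) = Z * mat_diag n (\<lambda>i. c i / d i) * ?Y" for c
  proof -
    have "mat_inv G * (transpose_mat ?Y * mat_diag n c * ?Y)
        = Z * (?E * (transpose_mat Z * (transpose_mat ?Y * (mat_diag n c * ?Y))))"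
      unfolding Gi using Z(1) Zt Y(1) Yt by (simp add: assoc mc)
    also have "transpose_mat Z * (transpose_mat ?Y * (mat_diag n c * ?Y)) = mat_diag n c * ?Y"
      by (rule ZYx[of _ n]) (use Y(1) in \<open>simp add: mc\<close>)
    also have "Z * (?E * (mat_diag n c * ?Y)) = Z * (?E * mat_diag n c) * ?Y"
      using Z(1) Y(1) by (simp add: assoc mc del: mat_diag_diag)
    also have "?E * mat_diag n c = mat_diag n (\<lambda>i. c i / d i)" by simp
    finally show ?thesis .
  qed
  have "Z * mat_diag n (\<lambda>i. d i / d i) * ?Y = 1\<^sub>m n"
  proof -
    have "mat_diag n (\<lambda>i. d i / d i) = 1\<^sub>m n"
      by (rule eq_matI) (use d in \<open>auto simp: mat_diag_def dest: less_imp_neq[symmetric]\<close>)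
    then show ?thesis using Z(1) Y by simp
  qed
  then show "mat_inv G * G = 1\<^sub>m n" using Gi_cong[of d] by (simp add: Geq)
  show "v \<bullet> (G *\<^sub>v v) > 0" if "v \<in> carrier_vec n" "v \<noteq> 0\<^sub>v n" for v
    unfolding Geq by (rule diagonal_congruence_posdef[OF Z d that])
  have "mat_inv G * (transpose_mat A * A) * Z = Z * mat_diag n \<mu> * ?Y * Z"
    unfolding AA Gi_cong mu ..
  also have "\<dots> = Z * mat_diag n \<mu>"
    using Z(1) Y by (simp add: assoc mc right_mult_one_mat[of _ n n])
  finally show "mat_inv G * (transpose_mat A * A) * Z = Z * mat_diag n \<mu>" .
  have UAc: "U\<^sub>A \<in> carrier_mat m m" using UA by (simp add: orthonormal_mat_def)
  show "mat_inv G *\<^sub>v (transpose_mat A *\<^sub>v b) = Z *\<^sub>v vec n (\<lambda>i. \<mu> i * ((col U\<^sub>A i \<bullet> b) / \<sigma> i))"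
  proof -
    define g where "g = transpose_mat DA *\<^sub>v (transpose_mat U\<^sub>A *\<^sub>v b)"
    have Ub: "transpose_mat U\<^sub>A *\<^sub>v b \<in> carrier_vec m" using UAc b by simp
    have DAt: "transpose_mat DA \<in> carrier_mat n m" using DA by simp
    have gc: "g \<in> carrier_vec n" unfolding g_def by (rule mult_mat_vec_carrier[OF DAt Ub])
    have UDA: "U\<^sub>A * DA \<in> carrier_mat m n" by (rule mult_carrier_mat[OF UAc DA])
    have UDAt: "transpose_mat DA * transpose_mat U\<^sub>A \<in> carrier_mat n m"
      using UAc by (intro mult_carrier_mat[OF DAt]) simp
    have "transpose_mat A = transpose_mat ?Y * (transpose_mat DA * transpose_mat U\<^sub>A)"
      unfolding Aeq transpose_mult[OF UDA Y(1)] transpose_mult[OF UAc DA] ..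
    then have At: "transpose_mat A *\<^sub>v b = transpose_mat ?Y *\<^sub>v g"
      unfolding g_def using assoc_mult_mat_vec[OF Yt UDAt b] assoc_mult_mat_vec[OF DAt _ b] UAc by simp
    have Yg: "transpose_mat ?Y *\<^sub>v g \<in> carrier_vec n" by (rule mult_mat_vec_carrier[OF Yt gc])
    have "transpose_mat Z *\<^sub>v (transpose_mat ?Y *\<^sub>v g) = g"
      using assoc_mult_mat_vec[OF Zt Yt gc] ZY gc by simp
    then have "mat_inv G *\<^sub>v (transpose_mat A *\<^sub>v b) = Z *\<^sub>v (?E *\<^sub>v g)"
      unfolding Gi At using Z(1) Zt Yg gc
      by (simp add: assoc_mult_mat_vec[of _ n n _ n] mc)
    also have "?E *\<^sub>v g = vec n (\<lambda>i. \<mu> i * ((col U\<^sub>A i \<bullet> b) / \<sigma> i))"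
      unfolding mat_diag_mult_vec[OF gc]
    proof (rule eq_vecI)
      fix i assume "i < dim_vec (vec n (\<lambda>i. \<mu> i * ((col U\<^sub>A i \<bullet> b) / \<sigma> i)))"
      then have i: "i < n" by simp
      have "g $ i = (\<Sum>h<m. transpose_mat DA $$ (i, h) * (transpose_mat U\<^sub>A *\<^sub>v b) $ h)"
        unfolding g_def by (rule mult_mat_vec_entry_sum[OF DAt Ub i])
      also have "\<dots> = (\<Sum>h<m. if h = i then \<sigma> i * (col U\<^sub>A i \<bullet> b) else 0)"
        by (rule sum.cong) (use i DA UAc DA_entry in auto)
      also have "\<dots> = \<sigma> i * (col U\<^sub>A i \<bullet> b)" using i le by simp
      finally show "vec n (\<lambda>i. 1 / d i * g $ i) $ i = vec n (\<lambda>i. \<mu> i * ((col U\<^sub>A i \<bullet> b) / \<sigma> i)) $ i"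
        using i sigma_pos[OF i] by (simp add: mu power2_eq_square)
    qed simp
    finally show ?thesis .
  qed
  show "\<mu> j \<le> \<mu> i" if ij: "i \<le> j" "j < n" for i j
  proof -
    have s: "(\<sigma> j)\<^sup>2 \<le> (\<sigma> i)\<^sup>2"
    proof (rule power_mono)
      show "\<sigma> j \<le> \<sigma> i"
        using mono[of i j] pos[of j] sigma_one[of i] sigma_one[of j] ij
        by (cases "i < r"; cases "j < r") auto
    qed (use sigma_pos[of j] ij in simp)
    have t: "(\<rho>' i)\<^sup>2 \<le> (\<rho>' j)\<^sup>2"
      using mono[of i j] pos[of i] ij by (auto simp: \<rho>'_def intro!: power_mono)
    have "(\<sigma> j)\<^sup>2 * (\<rho>' i)\<^sup>2 \<le> (\<sigma> i)\<^sup>2 * (\<rho>' j)\<^sup>2" by (rule mult_mono[OF s t]) auto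
    then have "\<alpha> * ((\<sigma> j)\<^sup>2 * (\<rho>' i)\<^sup>2) \<le> \<alpha> * ((\<sigma> i)\<^sup>2 * (\<rho>' j)\<^sup>2)" using alpha by simp
    then have "(\<sigma> j)\<^sup>2 * d i \<le> (\<sigma> i)\<^sup>2 * d j" by (simp add: d_def algebra_simps)
    moreover have "d i > 0" "d j > 0" using d ij by auto
    ultimately have "(\<sigma> j)\<^sup>2 \<le> (\<sigma> i)\<^sup>2 * d j / d i" by (intro mult_imp_le_div_pos)
    then have "(\<sigma> j)\<^sup>2 \<le> (\<sigma> i)\<^sup>2 / d i * d j" by simp
    with \<open>d j > 0\<close> show ?thesis unfolding mu by (rule mult_imp_div_pos_le)
  qed
qed

section \<open>The filter factors\<close>

lemma pgkb_solution_richardson: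
  assumes A: "A \<in> carrier_mat m n" and b: "b \<in> carrier_vec m"
    and H: "mat_inv G \<in> carrier_mat n n"
    and posdef: "\<And>v. v \<in> carrier_vec n \<Longrightarrow> v \<noteq> 0\<^sub>v n \<Longrightarrow> v \<bullet> (G *\<^sub>v v) > 0"
    and k: "0 < k" and nz: "\<And>i. i < k \<Longrightarrow> pgkb_alpha A G b i \<noteq> 0"
    and sv: "is_singular_values (pgkb_B A G b k) \<theta>" and \<theta>: "\<And>i. i < k \<Longrightarrow> \<theta> i > 0"
  shows "pgkb_solution A G b k =
    richardson (mat_inv G * (transpose_mat A * A)) (\<lambda>j. (\<theta> j)\<^sup>2)
      (mat_inv G *\<^sub>v (transpose_mat A *\<^sub>v b)) k"
proof -
  let ?B = "pgkb_B A G b k" and ?a = "pgkb_alpha A G b" and ?\<beta> = "pgkb_beta A G b"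
  let ?e = "(?\<beta> 0 * ?a 0) \<cdot>\<^sub>v unit_vec k 0" and ?c = "?\<beta> 0 \<cdot>\<^sub>v unit_vec (k + 1) 0"
  define T where "T = transpose_mat ?B * ?B"
  define y where "y = richardson T (\<lambda>j. (\<theta> j)\<^sup>2) ?e k"
  have B: "?B \<in> carrier_mat (k + 1) k"
    by (simp only: pgkb_B_lower_bidiagonal lower_bidiagonal_carrier)
  have Bt: "transpose_mat ?B \<in> carrier_mat k (k + 1)" using B by simp
  have T: "T \<in> carrier_mat k k" unfolding T_def using Bt B by (rule mult_carrier_mat)
  have y: "y \<in> carrier_vec k" unfolding y_def using T by simp
  have c: "?c \<in> carrier_vec (k + 1)" by simp
  obtain V where V: "orthonormal_mat k V" and diag: "T * V = V * mat_diag k (\<lambda>i. (\<theta> i)\<^sup>2)"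
    using singular_values_diagonalize_gram[OF B _ sv] unfolding T_def by auto
  have "(\<theta> i)\<^sup>2 \<noteq> 0" if "i < k" for i using \<theta>[OF that] by simp
  then have Ty: "T *\<^sub>v y = ?e"
    unfolding y_def by (intro richardson_exact[OF T V diag]) auto
  have "transpose_mat ?B *\<^sub>v ?c = ?e"
  proof (rule eq_vecI)
    fix i assume "i < dim_vec ?e"
    then show "(transpose_mat ?B *\<^sub>v ?c) $ i = ?e $ i"
      using lower_bidiagonal_transpose_mult_vec[OF c, of i ?a "\<lambda>j. ?\<beta> (j + 1)"]
      unfolding pgkb_B_lower_bidiagonal by simp
  qed (use B in simp)
  then have normal: "transpose_mat ?B *\<^sub>v (?B *\<^sub>v y) = transpose_mat ?B *\<^sub>v ?c"
    using Ty assoc_mult_mat_vec[OF Bt B y] by (simp add: T_def)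
  have "v = 0\<^sub>v k" if "v \<in> carrier_vec k" "?B *\<^sub>v v = 0\<^sub>v (k + 1)" for v
    using lower_bidiagonal_injective[where a = ?a, OF _ that(1)] nz that(2) unfolding pgkb_B_lower_bidiagonal by blast
  then have "pgkb_y A G b k = y"
    unfolding pgkb_y_def by (intro least_squares_minimizer[OF B c y normal])
  then have "pgkb_solution A G b k = pgkb_W A G b k *\<^sub>v y" by (simp add: pgkb_solution_def)
  also have "\<dots> = richardson (mat_inv G * (transpose_mat A * A)) (\<lambda>j. (\<theta> j)\<^sup>2)
      ((?\<beta> 0 * ?a 0) \<cdot>\<^sub>v pgkb_w A G b 0) k"
    unfolding y_def T_def by (rule pgkb_W_richardson[OF A b H posdef k order_refl])
  also have "(?\<beta> 0 * ?a 0) \<cdot>\<^sub>v pgkb_w A G b 0 = mat_inv G *\<^sub>v (transpose_mat A *\<^sub>v b)"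
  proof -
    let ?u = "pgkb_u A G b 0"
    have u: "?u \<in> carrier_vec m" by (rule pgkb_carrier[OF A b H posdef])
    have "mat_inv G *\<^sub>v (transpose_mat A *\<^sub>v (?\<beta> 0 \<cdot>\<^sub>v ?u))
        = ?\<beta> 0 \<cdot>\<^sub>v (mat_inv G *\<^sub>v (transpose_mat A *\<^sub>v ?u))"
      using A H u by (simp add: mult_mat_vec[of _ n m] mult_mat_vec[of _ n n])
    moreover have "?\<beta> 0 \<cdot>\<^sub>v ?u = b" by (rule pgkb_start(1)[OF A b H posdef])
    moreover have "?a 0 \<cdot>\<^sub>v pgkb_w A G b 0 = mat_inv G *\<^sub>v (transpose_mat A *\<^sub>v ?u)"
      by (rule pgkb_start(2)[OF A b H posdef])
    ultimately show ?thesis by (metis smult_smult_assoc)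
  qed
  finally show ?thesis .
qed

theorem theorem4p1:
  fixes A L M G U\<^sub>A U\<^sub>L Z :: "real mat" and b :: "real vec" and \<alpha> :: real
    and m n p r q k :: nat and \<sigma> \<rho> \<gamma> \<theta> \<xi> f :: "nat \<Rightarrow> real"
  assumes A: "A \<in> carrier_mat m n" and b: "b \<in> carrier_vec m"
    and L: "L \<in> carrier_mat p n" "p \<le> n" "vec_space.rank p L = p"
    and M: "M = transpose_mat L * L"
    and kernels: "mat_kernel A \<inter> mat_kernel L = {0\<^sub>v n}"
    and alpha: "\<alpha> > 0"
    and G: "G = transpose_mat A * A + \<alpha> \<cdot>\<^sub>m M"
    and gsvd: "is_gsvd A L m n p r q U\<^sub>A U\<^sub>L Z \<sigma> \<rho>"
    and sigma_one: "\<And>i. i < r \<Longrightarrow> \<sigma> i = 1"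
    and gamma: "\<And>i. r \<le> i \<Longrightarrow> i < r + q \<Longrightarrow> \<gamma> i = \<sigma> i / \<rho> i"
    and full_rank: "vec_space.rank m A = n"
    and k: "1 \<le> k"
    and no_termination: "\<And>i. i < k \<Longrightarrow> pgkb_alpha A G b i \<noteq> 0 \<and> pgkb_beta A G b i \<noteq> 0"
    and theta: "is_singular_values (pgkb_B A G b k) \<theta>"
    and xi: "is_generalized_eigenvalues n (transpose_mat A * A) G \<xi>"
    and f: "\<And>i. i < n \<Longrightarrow> f i = 1 - (\<Prod>j<k. ((\<theta> j)\<^sup>2 - \<xi> i) / (\<theta> j)\<^sup>2)"
  shows "r + q = n
    \<and> (\<forall>i<k. \<theta> i > 0) \<and> (\<forall>i j. i < j \<longrightarrow> j < k \<longrightarrow> \<theta> j < \<theta> i)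
    \<and> (\<forall>i<r. \<xi> i = 1)
    \<and> (\<forall>i. r \<le> i \<longrightarrow> i < n \<longrightarrow> \<xi> i = (\<gamma> i)\<^sup>2 / ((\<gamma> i)\<^sup>2 + \<alpha>))
    \<and> pgkb_solution A G b k =
        finsum_vec TYPE(real) n (\<lambda>i. (f i * ((col U\<^sub>A i \<bullet> b) / \<sigma> i)) \<cdot>\<^sub>v col Z i) {..<n}"
proof -
  let ?K = "mat_inv G * (transpose_mat A * A)"
  define \<mu> where "\<mu> i = (if i < r then 1 else (\<sigma> i)\<^sup>2 / ((\<sigma> i)\<^sup>2 + \<alpha> * (\<rho> i)\<^sup>2))" for i
  have Geq: "G = transpose_mat A * A + \<alpha> \<cdot>\<^sub>m (transpose_mat L * L)" unfolding G M ..
  have rq: "r + q = n" by (rule gsvd_full_column_rank[OF gsvd A full_rank])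
  note gsvd_facts = gsvd_normal_operator[OF gsvd rq sigma_one alpha b, folded Geq, folded \<mu>_def]
  have H: "mat_inv G \<in> carrier_mat n n" by (rule gsvd_facts(1))
  have HG: "mat_inv G * G = 1\<^sub>m n" by (rule gsvd_facts(2))
  have posdef: "\<And>v. v \<in> carrier_vec n \<Longrightarrow> v \<noteq> 0\<^sub>v n \<Longrightarrow> v \<bullet> (G *\<^sub>v v) > 0"
    by (rule gsvd_facts(3))
  have KZ: "?K * Z = Z * mat_diag n \<mu>" by (rule gsvd_facts(4))
  have rhs: "mat_inv G *\<^sub>v (transpose_mat A *\<^sub>v b) = Z *\<^sub>v vec n (\<lambda>i. \<mu> i * ((col U\<^sub>A i \<bullet> b) / \<sigma> i))"
    by (rule gsvd_facts(5))
  have \<mu>_decr: "\<And>i j. i \<le> j \<Longrightarrow> j < n \<Longrightarrow> \<mu> j \<le> \<mu> i" by (rule gsvd_facts(6))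
  have Z: "Z \<in> carrier_mat n n" "invertible_mat Z" using gsvd by (auto simp: is_gsvd_def)
  have Gc: "G \<in> carrier_mat n n" using A L unfolding Geq by auto
  have AA: "transpose_mat A * A \<in> carrier_mat n n" using A by simp
  have K: "?K \<in> carrier_mat n n" using H AA by (rule mult_carrier_mat)

  have \<theta>_bidiagonal:
    "is_singular_values (lower_bidiagonal k (pgkb_alpha A G b) (\<lambda>j. pgkb_beta A G b (j + 1))) \<theta>"
    using theta by (simp only: pgkb_B_lower_bidiagonal)
  have entries: "\<And>i. i < k \<Longrightarrow> pgkb_alpha A G b i \<noteq> 0"
    "\<And>i. i + 1 < k \<Longrightarrow> pgkb_beta A G b (i + 1) \<noteq> 0"
    using no_termination by blast+
  have \<theta>_pos: "\<forall>i<k. \<theta> i > 0"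
    by (rule bidiagonal_singular_values_distinct(1)[OF _ _ \<theta>_bidiagonal]) (fact entries)+
  have \<theta>_decr: "\<forall>i j. i < j \<longrightarrow> j < k \<longrightarrow> \<theta> j < \<theta> i"
    by (rule bidiagonal_singular_values_distinct(2)[OF _ _ \<theta>_bidiagonal]) (fact entries)+

  \<comment> \<open>Both \<open>Z\<close> and the given eigenvectors \<open>X\<close> diagonalize \<open>K\<close>, with eigenvalues in decreasing order.\<close>
  have xi_eq: "\<mu> i = \<xi> i" if "i < n" for i
  proof -
    have decr: "\<xi> j \<le> \<xi> i" if "i \<le> j" "j < n" for i j
      using xi that by (simp add: is_generalized_eigenvalues_def)
    from xi have "\<exists>X \<in> carrier_mat n n. invertible_mat X \<and>
        (\<forall>i<n. (transpose_mat A * A) *\<^sub>v col X i = \<xi> i \<cdot>\<^sub>v (G *\<^sub>v col X i))"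
      unfolding is_generalized_eigenvalues_def by (rule conjunct2)
    then obtain X where X: "X \<in> carrier_mat n n" "invertible_mat X"
      and eig: "\<forall>i<n. (transpose_mat A * A) *\<^sub>v col X i = \<xi> i \<cdot>\<^sub>v (G *\<^sub>v col X i)"
      by (elim bexE conjE)
    have "?K * X = X * mat_diag n \<xi>"
    proof (rule mat_col_eqI)
      fix j assume "j < dim_col (X * mat_diag n \<xi>)"
      then have j: "j < n" by (simp add: mat_diag_def)
      have x: "col X j \<in> carrier_vec n" using X j by (metis carrier_matD(1) col_dim)
      have "col (?K * X) j = ?K *\<^sub>v col X j" by (rule col_mult2[OF K X(1) j])
      also have "\<dots> = mat_inv G *\<^sub>v (\<xi> j \<cdot>\<^sub>v (G *\<^sub>v col X j))"
        unfolding eig[rule_format, OF j, symmetric] by (rule assoc_mult_mat_vec[OF H AA x])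
      also have "\<dots> = \<xi> j \<cdot>\<^sub>v (mat_inv G *\<^sub>v (G *\<^sub>v col X j))"
        by (rule mult_mat_vec[OF H mult_mat_vec_carrier[OF Gc x]])
      also have "mat_inv G *\<^sub>v (G *\<^sub>v col X j) = col X j"
        using assoc_mult_mat_vec[OF H Gc x] HG x by simp
      also have "\<xi> j \<cdot>\<^sub>v col X j = col (X * mat_diag n \<xi>) j"
        unfolding mat_diag_mult_right[OF X(1)]
        by (rule eq_vecI) (use j X in auto)
      finally show "col (?K * X) j = col (X * mat_diag n \<xi>) j" .
    qed (use X H in \<open>simp_all add: mat_diag_def\<close>)
    then show ?thesis
      by (rule diagonalization_unique[OF K X(1) Z(1) X(2) Z(2) _ KZ _ _ that])
        (fact decr \<mu>_decr)+
  qed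

  have "pgkb_solution A G b k
      = richardson ?K (\<lambda>j. (\<theta> j)\<^sup>2) (mat_inv G *\<^sub>v (transpose_mat A *\<^sub>v b)) k"
    using k no_termination \<theta>_pos
    by (intro pgkb_solution_richardson[OF A b H posdef _ _ theta]) auto
  also have "\<dots> = Z *\<^sub>v vec n (\<lambda>i. (1 - (\<Prod>j<k. 1 - \<mu> i / (\<theta> j)\<^sup>2)) * ((col U\<^sub>A i \<bullet> b) / \<sigma> i))"
    unfolding rhs by (rule richardson_diagonalized[OF K Z(1) KZ])
  also have "\<dots> = Z *\<^sub>v vec n (\<lambda>i. f i * ((col U\<^sub>A i \<bullet> b) / \<sigma> i))"
  proof -
    have "(1 - (\<Prod>j<k. 1 - \<mu> i / (\<theta> j)\<^sup>2)) = f i" if "i < n" for i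
    proof -
      have "(\<Prod>j<k. 1 - \<mu> i / (\<theta> j)\<^sup>2) = (\<Prod>j<k. ((\<theta> j)\<^sup>2 - \<xi> i) / (\<theta> j)\<^sup>2)"
      proof (rule prod.cong)
        fix j assume "j \<in> {..<k}"
        then have "\<theta> j > 0" using \<theta>_pos by simp
        then show "1 - \<mu> i / (\<theta> j)\<^sup>2 = ((\<theta> j)\<^sup>2 - \<xi> i) / (\<theta> j)\<^sup>2"
          using xi_eq[OF that] by (simp add: diff_divide_distrib)
      qed simp
      then show ?thesis using f[OF that] by simp
    qed
    then show ?thesis by (intro arg_cong[of _ _ "\<lambda>v. Z *\<^sub>v v"] eq_vecI) auto
  qed
  also have "\<dots> = finsum_vec TYPE(real) n (\<lambda>i. (f i * ((col U\<^sub>A i \<bullet> b) / \<sigma> i)) \<cdot>\<^sub>v col Z i) {..<n}"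
    (is "_ = ?F")
  proof (rule eq_vecI)
    have zc: "(\<lambda>i. (f i * ((col U\<^sub>A i \<bullet> b) / \<sigma> i)) \<cdot>\<^sub>v col Z i) \<in> {..<n} \<rightarrow> carrier_vec n"
      using Z(1) by auto
    have F: "?F \<in> carrier_vec n" by (rule finsum_vec_closed[OF zc])
    then show "dim_vec (Z *\<^sub>v vec n (\<lambda>i. f i * ((col U\<^sub>A i \<bullet> b) / \<sigma> i))) = dim_vec ?F"
      using Z(1) by simp
    fix i assume "i < dim_vec ?F"
    then have i: "i < n" using F by simp
    have "(Z *\<^sub>v vec n (\<lambda>i. f i * ((col U\<^sub>A i \<bullet> b) / \<sigma> i))) $ i
        = (\<Sum>j<n. Z $$ (i, j) * vec n (\<lambda>i. f i * ((col U\<^sub>A i \<bullet> b) / \<sigma> i)) $ j)"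
      by (rule mult_mat_vec_entry_sum[OF Z(1) _ i]) simp
    also have "\<dots> = ?F $ i"
      unfolding index_finsum_vec[OF finite_lessThan i zc]
      by (rule sum.cong) (use Z(1) i in auto)
    finally show "(Z *\<^sub>v vec n (\<lambda>i. f i * ((col U\<^sub>A i \<bullet> b) / \<sigma> i))) $ i = ?F $ i" .
  qed
  finally have solution: "pgkb_solution A G b k = ?F" .

  have "\<xi> i = 1" if "i < r" for i
    using xi_eq[of i] that rq by (simp add: \<mu>_def)
  moreover have "\<xi> i = (\<gamma> i)\<^sup>2 / ((\<gamma> i)\<^sup>2 + \<alpha>)" if "r \<le> i" "i < n" for i
  proof -
    have rho: "0 < \<rho> i" and g: "\<gamma> i = \<sigma> i / \<rho> i"
      using gsvd gamma[of i] that rq by (auto simp: is_gsvd_def)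
    have "\<xi> i = (\<sigma> i)\<^sup>2 / ((\<sigma> i)\<^sup>2 + \<alpha> * (\<rho> i)\<^sup>2)"
      using xi_eq[of i] that by (simp add: \<mu>_def)
    also have "\<dots> = ((\<sigma> i)\<^sup>2 / (\<rho> i)\<^sup>2) / (((\<sigma> i)\<^sup>2 + \<alpha> * (\<rho> i)\<^sup>2) / (\<rho> i)\<^sup>2)"
      using rho by simp
    also have "((\<sigma> i)\<^sup>2 + \<alpha> * (\<rho> i)\<^sup>2) / (\<rho> i)\<^sup>2 = (\<sigma> i)\<^sup>2 / (\<rho> i)\<^sup>2 + \<alpha>"
      using rho by (simp add: add_divide_distrib)
    finally show ?thesis by (simp add: g power_divide)
  qed
  ultimately show ?thesis using rq \<theta>_pos \<theta>_decr solution by blast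
qed

end
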